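(* Let $n$ be a non-negative integer and let $$\Theta_2(n,1)=\sum_{k=1}^\infty (-1)^k\frac{\psi\left(\frac{2k+2n+5}{4}\right)-\psi\left(\frac{2k+2n+3}{4}\right)}{(2k+1)^2}.$$ Then: (i) if $n=0$: $\Theta_2(0,1)=-4+\left(1-\frac14\ln^2 2\right)\pi-\frac{\pi^3}{8}+4\,\Im(\mathrm{Li}_3(1+i))$; (ii) if $n=1$: $\Theta_2(1,1)=\frac{11}{3}-\left(3-\frac12\ln^2 2\right)\frac{\pi}{2}+\frac{\pi^3}{8}+2G-4\,\Im(\mathrm{Li}_3(1+i))$; (iii) if $n$ is odd and $n\neq 1$: $$\Theta_2(n,1)=5-\sum_{j=1}^{\frac{n-1}{2}}\frac{1}{4j^2(4j+1)}+4\sum_{j=1}^{n}\frac{(-1)^j}{2j+1}+\frac14\sum_{k=1}^{\frac{n-1}{2}}\sum_{j=0}^{2k}\frac{(-1)^j(8k^2+4k+1)}{k^2(2j+1)(2k+1)^2}+\left(2-\sum_{j=1}^{\frac{n-1}{2}}\frac{1}{j(2j+1)}\right)G-\left(3+\sum_{j=1}^{\frac{n-1}{2}}\frac{1}{(2j+1)^2}-\frac12\ln^2 2\right)\frac{\pi}{2}+\frac{\pi^3}{8}-4\,\Im(\mathrm{Li}_3(1+i));$$ (iv) if $n$ is even: $$\Theta_2(n,1)=-4+\frac14\sum_{j=1}^{\frac n2}\frac{1}{j^2(4j-1)}-4\sum_{j=1}^{n}\frac{(-1)^j}{2j+1}-\frac14\sum_{k=1}^{\frac n2}\sum_{j=0}^{2k-2}\frac{(-1)^j(8k^2-4k+1)}{k^2(2j+1)(2k-1)^2}+\left(1+\frac12\sum_{j=1}^{\frac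 n2}\frac{1}{(2j-1)^2}-\frac14\ln^2 2\right)\pi-\frac{\pi^3}{8}-G\sum_{j=1}^{\frac n2}\frac{1}{j(2j-1)}+4\,\Im(\mathrm{Li}_3(1+i)).$$
   Context: $\psi=\Gamma'/\Gamma$ is the digamma function, $G=\sum_{k=0}^\infty\frac{(-1)^k}{(2k+1)^2}$ is Catalan's constant, and $\mathrm{Li}_3$ is the trilogarithm, $\mathrm{Li}_3(z)=\sum_{k\ge1}z^k/k^3$ for $|z|\le1$, analytically continued to $\mathbb C\setminus[1,\infty)$ (principal branch); $\Im(\mathrm{Li}_3(1+i))\approx1.2670834419$. Empty sums are $0$. *)

theory Defs
  imports "HOL-Complex_Analysis.Complex_Analysis"
begin

definition catalan :: real where
  "catalan = (\<Sum>k. (-1) ^ k / (2 * real k + 1)\<^sup>2)"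

definition Li3_series :: "complex \<Rightarrow> complex" where
  "Li3_series z = (\<Sum>k. z ^ Suc k / of_nat (Suc k) ^ 3)"

definition slit_plane :: "complex set" where
  "slit_plane = - (complex_of_real ` {1..})"

text \<open>
  The principal branch of the trilogarithm: the value at \<open>z\<close> of the analytic continuation of the
  series to the plane cut along $[1,\infty)$. The value is determined for \<open>z\<close> in the slit plane
  and at \<open>z = 1\<close>, and unspecified on the rest of the cut; see \<open>Li3_eq_series\<close>,
  \<open>Li3_holomorphic\<close> and \<open>Li3_unique\<close> below.
\<close>
definition Li3 :: "complex \<Rightarrow> complex" where
  "Li3 z = (THE w. \<exists>f. f holomorphic_on slit_plane \<and>
                       (\<forall>u\<in>cball 0 1. f u = Li3_series u) \<and> f z = w)"

text \<open>The series starts at $k = 1$, hence the shift by \<open>Suc\<close>.\<close>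
definition Theta2_term :: "nat \<Rightarrow> nat \<Rightarrow> real" where
  "Theta2_term n k =
     (-1) ^ k * (Digamma ((2 * real k + 2 * real n + 5) / 4)
               - Digamma ((2 * real k + 2 * real n + 3) / 4)) / (2 * real k + 1)\<^sup>2"

definition Theta2_at_1 :: "nat \<Rightarrow> real" where
  "Theta2_at_1 n = (\<Sum>k. Theta2_term n (Suc k))"


subsection \<open>The infinite sums converge\<close>

lemma summable_inverse_odd_squares: "summable (\<lambda>k. 1 / (2 * real k + 1)\<^sup>2)"
proof (rule summable_comparison_test')
  show "summable (\<lambda>k. 1 / real (Suc k) ^ 2)"
    using inverse_power_summable[of 2, where 'a = real]
    by (subst summable_Suc_iff[of "\<lambda>k. 1 / real k ^ 2"]) (simp add: inverse_eq_divide)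
  show "norm (1 / (2 * real k + 1)\<^sup>2) \<le> 1 / real (Suc k) ^ 2" if "k \<ge> 0" for k
    by (auto intro!: divide_left_mono power_mono)
qed

lemma catalan_summable: "summable (\<lambda>k. (-1) ^ k / (2 * real k + 1)\<^sup>2)"
  by (rule summable_comparison_test'[OF summable_inverse_odd_squares, where N = 0])
     (simp add: norm_divide norm_power)

lemma Theta2_summable: "summable (\<lambda>k. Theta2_term n (Suc k))"
proof (subst summable_Suc_iff, rule summable_comparison_test')
  show "summable (\<lambda>k. 2 * (1 / (2 * real k + 1)\<^sup>2))"
    by (intro summable_mult summable_inverse_odd_squares)
  fix k :: nat
  define x where "x = (2 * real k + 2 * real n + 3) / 4"
  have x: "x \<ge> 3 / 4" by (simp add: x_def)
  have y: "(2 * real k + 2 * real n + 5) / 4 = x + 1 / 2" by (simp add: x_def field_simps)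
  have "Digamma x \<le> Digamma (x + 1 / 2)"
    using x by (intro Polygamma_real_mono) auto
  moreover have "Digamma (x + 1 / 2) \<le> Digamma (x + 1)"
    using x by (intro Polygamma_real_mono) auto
  moreover have "Digamma (x + 1) = Digamma x + 1 / x"
    using x by (intro Digamma_plus1) auto
  moreover have "1 / x \<le> 2"
    using x by (simp add: field_simps)
  ultimately have "\<bar>Digamma (x + 1 / 2) - Digamma x\<bar> \<le> 2"
    by linarith
  then show "norm (Theta2_term n k) \<le> 2 * (1 / (2 * real k + 1)\<^sup>2)"
    by (simp add: Theta2_term_def y x_def[symmetric] abs_mult divide_right_mono)
qed


subsection \<open>Existence and uniqueness of the analytic continuation\<close>

lemma open_slit_plane: "open slit_plane"
proof -
  have "slit_plane = - {z. Im z = 0 \<and> Re z \<ge> 1}"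
    by (auto simp: slit_plane_def image_iff complex_eq_iff)
  moreover have "closed {z. Im z = 0 \<and> Re z \<ge> 1}"
    by (intro closed_Collect_conj closed_Collect_eq closed_Collect_le continuous_intros)
  ultimately show ?thesis by (metis open_Compl)
qed

lemma ball_subset_slit_plane: "ball 0 1 \<subseteq> slit_plane"
  by (auto simp: slit_plane_def)

lemma slit_plane_scale:
  assumes "z \<in> slit_plane" "0 \<le> t" "t \<le> 1"
  shows "of_real t * z \<in> slit_plane"
  unfolding slit_plane_def
proof (rule ComplI)
  assume *: "of_real t * z \<in> complex_of_real ` {1..}"
  then obtain r where r: "of_real t * z = complex_of_real r" "r \<ge> 1" by auto
  then have t: "t > 0" using assms by (cases "t = 0") auto
  then have "z = complex_of_real (r / t)" using r by (simp add: field_simps)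
  moreover have "r / t \<ge> 1" using r t assms by (simp add: field_simps)
  ultimately have "z \<in> complex_of_real ` {1..}" by (intro image_eqI[of _ _ "r / t"]) auto
  then show False using assms by (auto simp: slit_plane_def)
qed

lemma starlike_slit_plane: "starlike slit_plane"
  unfolding starlike_def
proof (intro bexI[of _ 0] ballI subsetI)
  fix z x assume "z \<in> slit_plane" "x \<in> closed_segment 0 z"
  then show "x \<in> slit_plane"
    using slit_plane_scale[of z] by (auto simp: in_segment scaleR_conv_of_real)
qed (use ball_subset_slit_plane in auto)

lemma continuation_step:
  fixes a :: "nat \<Rightarrow> complex"
  assumes f: "f holomorphic_on slit_plane"
    and ser: "\<And>z. norm z < 1 \<Longrightarrow> (\<lambda>k. a k * z ^ Suc k) sums f z"
  obtains F where "F holomorphic_on slit_plane"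
    "\<And>z. norm z < 1 \<Longrightarrow> (\<lambda>k. a k / of_nat (Suc k) * z ^ Suc k) sums F z"
proof -
  have sm: "summable (\<lambda>k. a k * z ^ k)" if "norm z < 1" for z
    using ser[OF that] sums_mult[OF ser[OF that], of "1 / z"]
    by (cases "z = 0") (auto dest!: sums_summable simp: field_simps)
  define P where "P z = (\<Sum>k. a k * z ^ k)" for z
  have P_mult: "z * P z = f z" if "norm z < 1" for z
    using sums_unique[OF ser[OF that]] suminf_mult[OF sm[OF that], of z]
    by (simp add: P_def mult_ac)
  have P_hol: "P holomorphic_on ball 0 1"
    using sm by (intro power_series_holomorphic[where a = a])
                (auto simp: P_def summable_sums)
  define g where "g z = (if z \<in> ball 0 1 then P z else f z / z)" for z
  have "g holomorphic_on (ball 0 1 \<union> (slit_plane - {0}))"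
  proof (rule holomorphic_on_Un)
    show "g holomorphic_on ball 0 1"
      using P_hol by (rule holomorphic_transform) (auto simp: g_def)
    have "(\<lambda>z. f z / z) holomorphic_on slit_plane - {0}"
      by (intro holomorphic_intros holomorphic_on_subset[OF f]) auto
    then show "g holomorphic_on slit_plane - {0}"
      by (rule holomorphic_transform) (use P_mult in \<open>auto simp: g_def field_simps\<close>)
  qed (auto intro: open_slit_plane)
  moreover have "ball 0 1 \<union> (slit_plane - {0}) = slit_plane"
    using ball_subset_slit_plane by auto
  ultimately have "g holomorphic_on slit_plane" by simp
  then obtain F0 where F0: "\<And>z. z \<in> slit_plane \<Longrightarrow> (F0 has_field_derivative g z) (at z)"
    using holomorphic_starlike_primitive[of slit_plane g "{}"] open_slit_plane starlike_slit_plane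
    by (auto simp: holomorphic_on_imp_continuous_on holomorphic_on_open field_differentiable_def)
  define F where "F z = F0 z - F0 0" for z
  have F: "(F has_field_derivative g z) (at z)" if "z \<in> slit_plane" for z
    unfolding F_def using F0[OF that] by (auto intro!: derivative_eq_intros)
  define c where "c k = (if k = 0 then 0 else a (k - 1) / of_nat k)" for k
  have smc: "summable (\<lambda>k. c k * z ^ k)" if "norm z < 1" for z
  proof -
    define r where "r = (norm z + 1) / 2"
    have r: "norm z < r" "r < 1" using that by (auto simp: r_def)
    have "norm (complex_of_real r) < 1" using r by (simp add: abs_less_iff) (use norm_ge_zero[of z] in linarith)
    then have "summable (\<lambda>k. a k * of_real r ^ k)" by (rule sm)
    then have "summable (\<lambda>k. norm (a k * z ^ k))"
      by (rule powser_insidea) (use r norm_ge_zero[of z] in \<open>simp; linarith\<close>)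
    then have "summable (\<lambda>k. norm z * norm (a k * z ^ k))" by (rule summable_mult)
    then have "summable (\<lambda>k. c (Suc k) * z ^ Suc k)"
    proof (rule summable_comparison_test'[where N = 0])
      fix k :: nat
      have "norm (c (Suc k) * z ^ Suc k) = norm z * norm (a k * z ^ k) / real (Suc k)"
        by (simp add: c_def norm_mult norm_divide norm_power mult_ac del: of_nat_Suc)
      also have "\<dots> \<le> norm z * norm (a k * z ^ k) / 1"
        by (intro divide_left_mono) auto
      finally show "norm (c (Suc k) * z ^ Suc k) \<le> norm z * norm (a k * z ^ k)" by simp
    qed
    then show ?thesis by (subst (asm) summable_Suc_iff)
  qed
  have diffs_c: "diffs c = a"
    by (rule ext) (simp add: diffs_def c_def del: of_nat_Suc)
  define H where "H z = (\<Sum>k. c k * z ^ k)" for z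
  have H: "(H has_field_derivative g z) (at z)" if "norm z < 1" for z
    using termdiffs_strong'[of 1 c z] smc that
    by (simp add: H_def[abs_def] diffs_c g_def P_def)
  have FH: "F z = H z" if "norm z < 1" for z
  proof -
    have "\<exists>C. \<forall>x\<in>ball 0 1. F x - H x = C"
    proof (rule has_field_derivative_zero_constant)
      fix x :: complex assume x: "x \<in> ball 0 1"
      then have "((\<lambda>x. F x - H x) has_field_derivative g x - g x) (at x)"
        using ball_subset_slit_plane by (intro DERIV_diff F H) auto
      then show "((\<lambda>x. F x - H x) has_field_derivative 0) (at x within ball 0 1)"
        by (auto intro: has_field_derivative_at_within)
    qed auto
    then obtain C where C: "\<And>x. x \<in> ball 0 1 \<Longrightarrow> F x - H x = C" by auto
    have "F 0 - H 0 = 0" by (simp add: F_def H_def c_def)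
    with C[of 0] C[of z] that show ?thesis by simp
  qed
  show ?thesis
  proof (rule that)
    show "F holomorphic_on slit_plane"
      using F open_slit_plane by (auto simp: holomorphic_on_open)
    fix z :: complex assume z: "norm z < 1"
    have "(\<lambda>k. c k * z ^ k) sums F z"
      using FH[OF z] smc[OF z] by (simp add: H_def summable_sums)
    then have "(\<lambda>k. c (Suc k) * z ^ Suc k) sums F z"
      by (subst sums_Suc_iff) (simp add: c_def)
    then show "(\<lambda>k. a k / of_nat (Suc k) * z ^ Suc k) sums F z"
      by (simp add: c_def)
  qed
qed

lemma continuous_on_Li3_series: "continuous_on (cball 0 1) Li3_series"
proof -
  have "uniform_limit (cball 0 1) (\<lambda>n z. \<Sum>k<n. z ^ Suc k / of_nat (Suc k) ^ 3)
          (\<lambda>z::complex. \<Sum>k. z ^ Suc k / of_nat (Suc k) ^ 3) sequentially"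
  proof (rule Weierstrass_m_test)
    fix k :: nat and z :: complex assume "z \<in> cball 0 1"
    then show "norm (z ^ Suc k / of_nat (Suc k) ^ 3) \<le> 1 / real (Suc k) ^ 3"
      by (simp add: norm_divide norm_power norm_mult divide_right_mono power_le_one mult_le_one
               del: of_nat_Suc)
  next
    show "summable (\<lambda>k. 1 / real (Suc k) ^ 3)"
      using inverse_power_summable[of 3, where 'a = real]
      by (subst summable_Suc_iff[of "\<lambda>k. 1 / real k ^ 3"]) (simp add: inverse_eq_divide)
  qed
  then have "continuous_on (cball 0 1) (\<lambda>z::complex. \<Sum>k. z ^ Suc k / of_nat (Suc k) ^ 3)"
    by (rule uniform_limit_theorem[rotated])
       (auto intro!: always_eventually continuous_intros simp del: of_nat_Suc)
  then show ?thesis by (simp add: Li3_series_def[abs_def])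
qed

lemma Li3_continuation_exists:
  obtains f where "f holomorphic_on slit_plane" "\<And>u. norm u \<le> 1 \<Longrightarrow> f u = Li3_series u"
proof -
  have "(\<lambda>z. - Ln (1 - z)) holomorphic_on slit_plane"
  proof (intro holomorphic_intros)
    fix z assume z: "z \<in> slit_plane"
    show "1 - z \<notin> \<real>\<^sub>\<le>\<^sub>0"
    proof
      assume "1 - z \<in> \<real>\<^sub>\<le>\<^sub>0"
      then have "z = complex_of_real (Re z)" "Re z \<ge> 1"
        by (auto simp: complex_nonpos_Reals_iff complex_eq_iff)
      with z show False by (auto simp: slit_plane_def)
    qed
  qed
  moreover have "(\<lambda>k. 1 / of_nat (Suc k) * z ^ Suc k) sums (- Ln (1 - z))" if "norm z < 1" for z
  proof -
    have "(\<lambda>k. 1 / of_nat k * z ^ k) sums (- Ln (1 - z))"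
      using sums_minus[OF Ln_series[of "-z"]] that
      by (simp add: power_minus[of z] mult_ac flip: power_add)
    then show ?thesis by (subst sums_Suc_iff) simp
  qed
  ultimately obtain f2 where f2: "f2 holomorphic_on slit_plane"
    "\<And>z. norm z < 1 \<Longrightarrow> (\<lambda>k. 1 / of_nat (Suc k) / of_nat (Suc k) * z ^ Suc k) sums f2 z"
    by (rule continuation_step[where a = "\<lambda>k. 1 / of_nat (Suc k)"]) blast+
  obtain f where f: "f holomorphic_on slit_plane"
    "\<And>z. norm z < 1 \<Longrightarrow>
       (\<lambda>k. 1 / of_nat (Suc k) / of_nat (Suc k) / of_nat (Suc k) * z ^ Suc k) sums f z"
    using f2 by (rule continuation_step[where a = "\<lambda>k. 1 / of_nat (Suc k) / of_nat (Suc k)"]) blast+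
  have inside: "f z = Li3_series z" if "norm z < 1" for z
    using sums_unique[OF f(2)[OF that]]
    by (simp add: Li3_series_def power3_eq_cube del: of_nat_Suc)
  have bdry: "f u = Li3_series u" if u: "norm u \<le> 1" "u \<in> slit_plane" for u
  proof -
    define t where "t n = 1 - inverse (real (Suc n))" for n
    have t: "0 \<le> t n" "t n < 1" for n by (auto simp: t_def field_simps)
    have "t \<longlonglongrightarrow> 1 - 0" unfolding t_def
      by (intro tendsto_diff tendsto_const LIMSEQ_inverse_real_of_nat)
    then have "(\<lambda>n. of_real (t n) * u) \<longlonglongrightarrow> of_real 1 * u"
      by (intro tendsto_intros) simp
    then have lim: "(\<lambda>n. of_real (t n) * u) \<longlonglongrightarrow> u" by simp
    have nrm: "norm (of_real (t n) * u) < 1" for n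
    proof -
      have "t n * norm u \<le> t n * 1" using t u by (intro mult_left_mono) auto
      then show ?thesis using t[of n] by (simp add: norm_mult)
    qed
    have "(\<lambda>n. f (of_real (t n) * u)) \<longlonglongrightarrow> f u"
      by (rule continuous_on_tendsto_compose[OF holomorphic_on_imp_continuous_on[OF f(1)] lim u(2)])
         (use t in \<open>auto intro!: always_eventually slit_plane_scale u intro: less_imp_le\<close>)
    moreover have "(\<lambda>n. Li3_series (of_real (t n) * u)) \<longlonglongrightarrow> Li3_series u"
      by (rule continuous_on_tendsto_compose[OF continuous_on_Li3_series lim])
         (use u nrm in \<open>auto intro!: always_eventually less_imp_le\<close>)
    ultimately show ?thesis using inside[OF nrm] LIMSEQ_unique by simp
  qed
  show ?thesis
  proof (rule that)
    show "(\<lambda>z. if z \<in> slit_plane then f z else Li3_series z) holomorphic_on slit_plane"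
      using f(1) by (rule holomorphic_transform) auto
  qed (use bdry in auto)
qed

lemma Li3_unique:
  assumes f: "f holomorphic_on slit_plane" "\<And>u. norm u < 1 \<Longrightarrow> f u = Li3_series u"
    and z: "z \<in> slit_plane"
  shows "Li3 z = f z"
proof -
  have eq: "g z = f z"
    if g: "g holomorphic_on slit_plane" "\<forall>u\<in>cball 0 1. g u = Li3_series u" for g
  proof (rule analytic_continuation_open[where s = "ball 0 1" and s' = slit_plane and f = g and g = f])
    show "connected slit_plane"
      using starlike_slit_plane by (rule starlike_imp_connected)
    show "g u = f u" if "u \<in> ball 0 1" for u
      using that f g by auto
  qed (use f g z open_slit_plane ball_subset_slit_plane in auto)
  obtain h where h: "h holomorphic_on slit_plane" "\<And>u. norm u \<le> 1 \<Longrightarrow> h u = Li3_series u"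
    using Li3_continuation_exists by blast
  show ?thesis unfolding Li3_def
  proof (rule the_equality)
    show "\<exists>g. g holomorphic_on slit_plane \<and> (\<forall>u\<in>cball 0 1. g u = Li3_series u) \<and> g z = f z"
      using h eq[of h] by (intro exI[of _ h]) auto
  qed (use eq in auto)
qed

lemma Li3_holomorphic: "Li3 holomorphic_on slit_plane"
proof -
  obtain h where h: "h holomorphic_on slit_plane" "\<And>u. norm u \<le> 1 \<Longrightarrow> h u = Li3_series u"
    using Li3_continuation_exists by blast
  show ?thesis
    using h(1) by (rule holomorphic_transform) (use h Li3_unique[of h] in auto)
qed

lemma Li3_eq_series:
  assumes "norm u \<le> 1"
  shows "Li3 u = (\<Sum>k. u ^ Suc k / of_nat (Suc k) ^ 3)"
proof -
  obtain h where h: "h holomorphic_on slit_plane" "\<And>u. norm u \<le> 1 \<Longrightarrow> h u = Li3_series u"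
    using Li3_continuation_exists by blast
  have "Li3 u = Li3_series u"
    unfolding Li3_def
    by (rule the_equality) (use h assms in auto)
  then show ?thesis by (simp add: Li3_series_def)
qed

lemma one_plus_ii_in_slit_plane: "1 + \<i> \<in> slit_plane"
  by (auto simp: slit_plane_def complex_eq_iff)

end

theory Submission
  imports Defs
begin

text \<open>
  Write $B_n = \psi((2n+5)/4) - \psi((2n+3)/4)$ and $S_n = \sum_{k\ge0} (-1)^k B_{n+k}/(2k+1)^2$, so
  that the sum in question is $S_n - B_n$. The functional equation of $\psi$ gives
  $B_n + B_{n+1} = 4/(2n+3)$, and partial fractions turn this into
  $S_n + S_{n+1} = 2G/(n+1) + (B_n - \pi)/(4(n+1)^2)$. Applying it twice relates $S_{n+2}$ to $S_n$,
  so everything reduces to $S_0$.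

  Since $B_k = \int_0^1 4x^{2k+2}/(1+x^2)\,dx$, summation under the integral and integration by
  parts give $S_0 = 2G \ln 2 - 2\,\Im P(-i)$, where $P(0) = 0$ and $P'(w) = \ln^2(1-w)/w$. Off the cuts,
  $P(w)$ differs from $\ln w \ln^2(1-w) + 2 \ln(1-w)\,\mathrm{Li}_2(1-w) - 2\,\mathrm{Li}_3(1-w)$ by a
  constant, which is real because both are real at $w = 1/2$. The value of $\mathrm{Li}_2(1+i)$
  follows from Landen's identity (real part, as $z/(z-1) = \overline z$ at $z = 1+i$) and from the
  reflection formula (imaginary part, again with a constant that is real).
\<close>

subsection \<open>Polylogarithms on the slit plane\<close>

lemma slit_plane_iff: "z \<in> slit_plane \<longleftrightarrow> Im z \<noteq> 0 \<or> Re z < 1"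
  by (auto simp: slit_plane_def image_iff complex_eq_iff)

lemma zero_in_slit_plane [simp]: "0 \<in> slit_plane"
  by (simp add: slit_plane_iff)

lemma one_minus_notin_nonpos_Reals: "z \<in> slit_plane \<Longrightarrow> 1 - z \<notin> \<real>\<^sub>\<le>\<^sub>0"
  by (auto simp: slit_plane_iff complex_nonpos_Reals_iff)

lemma cnj_slit_plane [simp]: "cnj z \<in> slit_plane \<longleftrightarrow> z \<in> slit_plane"
  by (simp add: slit_plane_iff)

lemma holomorphic_Ln_one_minus: "(\<lambda>z. Ln (1 - z)) holomorphic_on slit_plane"
  by (intro holomorphic_intros) (rule one_minus_notin_nonpos_Reals)

lemma Ln_one_minus_deriv:
  "z \<in> slit_plane \<Longrightarrow> ((\<lambda>z. Ln (1 - z)) has_field_derivative - (1 / (1 - z))) (at z)"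
  using one_minus_notin_nonpos_Reals[of z]
  by (auto intro!: derivative_eq_intros simp: divide_inverse)

text \<open>Reduces an identity between analytic functions to one value at 0 and a derivative
  computation. Derivatives of polylogarithms are written with a division by z, hence the exclusion
  of 0 in the hypothesis; \<open>deriv D\<close> is holomorphic and vanishes off 0, so by analytic
  continuation it vanishes at 0 too.\<close>

lemma zero_on_slit_plane:
  assumes D: "D holomorphic_on slit_plane" "D 0 = 0"
    and D': "\<And>z. z \<in> slit_plane \<Longrightarrow> z \<noteq> 0 \<Longrightarrow> (D has_field_derivative 0) (at z)"
    and z: "z \<in> slit_plane"
  shows "D z = 0"
proof -
  have conn: "connected slit_plane"
    using starlike_slit_plane by (rule starlike_imp_connected)
  have D'0: "deriv D w = 0" if "w \<in> slit_plane" for w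
  proof (rule analytic_continuation_open[where s = "slit_plane - {0}" and s' = slit_plane
        and f = "deriv D" and g = "\<lambda>_. 0"])
    show "open (slit_plane - {0})"
      using open_slit_plane by (intro open_Diff) auto
    show "slit_plane - {0} \<noteq> {}"
      using slit_plane_iff[of \<i>] by auto
    show "deriv D holomorphic_on slit_plane"
      using D open_slit_plane by (intro holomorphic_deriv)
    show "deriv D u = 0" if "u \<in> slit_plane - {0}" for u
      using that D' by (auto intro: DERIV_imp_deriv)
  qed (use that conn open_slit_plane in auto)
  have "(D has_derivative (\<lambda>h. 0)) (at w within slit_plane)" if "w \<in> slit_plane" for w
    using holomorphic_derivI[OF D(1) open_slit_plane that] D'0[OF that]
    by (auto simp: has_field_derivative_def lambda_zero intro: has_derivative_at_withinI)
  then have "D z = D 0"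
    using conn open_slit_plane D(1) z
    by (intro has_derivative_zero_unique_strong_connected[of slit_plane "{}" D 0 "D 0" z])
       (auto simp: holomorphic_on_imp_continuous_on)
  then show ?thesis using D by simp
qed

text \<open>Schwarz reflection: \<open>cnj \<circ> F \<circ> cnj\<close> has the same value at 0 as
  \<open>F\<close> and, by the symmetry of \<open>f\<close>, the same derivative away from
  0.\<close>

lemma cnj_symmetric_primitive:
  assumes F: "F holomorphic_on slit_plane" "F 0 = 0"
    and F': "\<And>z. z \<in> slit_plane \<Longrightarrow> z \<noteq> 0 \<Longrightarrow> (F has_field_derivative f z) (at z)"
    and f: "\<And>z. z \<in> slit_plane \<Longrightarrow> f (cnj z) = cnj (f z)"
    and z: "z \<in> slit_plane"
  shows "F (cnj z) = cnj (F z)"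
proof -
  have "F z - cnj (F (cnj z)) = 0"
  proof (rule zero_on_slit_plane[where D = "\<lambda>z. F z - cnj (F (cnj z))"])
    have "cnj ` slit_plane = slit_plane"
      by (auto intro!: image_eqI[of _ cnj "cnj _"])
    then have "cnj \<circ> F \<circ> cnj holomorphic_on slit_plane"
      using F(1) open_slit_plane by (intro holomorphic_on_compose_cnj_cnj) auto
    then show "(\<lambda>z. F z - cnj (F (cnj z))) holomorphic_on slit_plane"
      using F(1) by (intro holomorphic_intros) (auto simp: o_def)
    fix w assume w: "w \<in> slit_plane" "w \<noteq> 0"
    have "(cnj \<circ> F \<circ> cnj has_field_derivative cnj (f (cnj w))) (at w)"
      using has_field_derivative_cnj_cnj[of F "f (cnj w)" w] F'[of "cnj w"] w by auto
    then have "((\<lambda>z. F z - cnj (F (cnj z))) has_field_derivative f w - cnj (f (cnj w))) (at w)"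
      using F'[OF w] by (intro DERIV_diff) (auto simp: o_def)
    then show "((\<lambda>z. F z - cnj (F (cnj z))) has_field_derivative 0) (at w)"
      using f[OF w(1)] by simp
  qed (use F z in auto)
  then show ?thesis by (metis complex_cnj_cnj right_minus_eq)
qed

text \<open>As \<open>f\<close> vanishes at 0, the singularity of \<open>f z / z\<close> there is
  removable, and a holomorphic function on a starlike open set has a primitive. This later supplies
  the function P of the overview.\<close>

lemma log_primitive:
  assumes f: "f holomorphic_on slit_plane" "f 0 = 0"
  obtains F where "F holomorphic_on slit_plane" "F 0 = 0"
    "\<And>z. z \<in> slit_plane \<Longrightarrow> z \<noteq> 0 \<Longrightarrow> (F has_field_derivative f z / z) (at z)"
proof -
  define g where "g z = (if z = 0 then deriv f 0 else f z / z)" for z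
  have g: "g holomorphic_on slit_plane"
  proof (rule pole_theorem_open_0[OF f(1) open_slit_plane, of 0 g])
    show "f z = (z - 0) * g z" if "z \<in> slit_plane - {0}" for z
      using that by (simp add: g_def)
    show "g 0 = deriv f 0" by (simp add: g_def)
  qed (rule f)
  have "\<exists>F. \<forall>z\<in>slit_plane. (F has_field_derivative g z) (at z)"
  proof (rule holomorphic_starlike_primitive[of _ _ "{}"])
    show "g field_differentiable at z" if "z \<in> slit_plane - {}" for z
      using that g open_slit_plane by (auto intro: holomorphic_on_imp_differentiable_at)
  qed (use g open_slit_plane starlike_slit_plane holomorphic_on_imp_continuous_on in auto)
  then obtain F where F: "\<And>z. z \<in> slit_plane \<Longrightarrow> (F has_field_derivative g z) (at z)"
    by blast
  have F2: "((\<lambda>z. F z - F 0) has_field_derivative g z) (at z)" if "z \<in> slit_plane" for z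
    using DERIV_diff[OF F[OF that] DERIV_const[of "F 0"]] by simp
  show ?thesis
  proof (rule that[of "\<lambda>z. F z - F 0"])
    show "(\<lambda>z. F z - F 0) holomorphic_on slit_plane"
      using F2 open_slit_plane by (auto simp: holomorphic_on_open)
    show "((\<lambda>z. F z - F 0) has_field_derivative f z / z) (at z)"
      if "z \<in> slit_plane" "z \<noteq> 0" for z
      using F2[OF that(1)] that(2) by (simp add: g_def)
  qed simp
qed

section \<open>The dilogarithm: series, derivative and conjugation symmetry\<close>

lemma sums_times_deriv:
  fixes a :: "nat \<Rightarrow> complex"
  assumes F: "F holomorphic_on ball 0 1"
    and ser: "\<And>z. norm z < 1 \<Longrightarrow> (\<lambda>k. a k * z ^ Suc k) sums F z"
    and z: "norm z < 1"
  shows "(\<lambda>k. of_nat (Suc k) * a k * z ^ Suc k) sums (z * deriv F z)"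
proof -
  \<comment> \<open>The series of \<open>F\<close> starts at exponent 1; \<open>c\<close> pads it
    with a zero constant term so that termwise differentiation applies. Multiplying the result by z
    restores the exponents, so z d/dz scales each coefficient by its exponent.\<close>
  define c where "c k = (if k = 0 then 0 else a (k - 1))" for k
  have "(\<lambda>k. c k * w ^ k) sums F w" if "norm w < 1" for w
  proof -
    have "(\<lambda>k. c (Suc k) * w ^ Suc k) sums F w" using ser[OF that] by (simp add: c_def)
    then show ?thesis by (subst (asm) sums_Suc_iff) (simp add: c_def)
  qed
  moreover have "(F has_field_derivative deriv F z) (at z)"
    using z by (intro holomorphic_derivI[OF F]) auto
  ultimately have "(\<lambda>k. diffs c k * z ^ k) sums deriv F z"
    using z by (intro termdiffs_sums_strong[where K = 1 and f = F])
  from sums_mult[OF this, of z] show ?thesis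
    by (simp add: diffs_def c_def mult_ac del: of_nat_Suc)
qed

text \<open>Defined through the derivative of \<open>Li3\<close>, so that holomorphy on the whole
  slit plane is inherited; \<open>Li2_sums\<close> identifies it with the usual dilogarithm series
  on the open disc.\<close>

definition Li2 :: "complex \<Rightarrow> complex" where
  "Li2 z = z * deriv Li3 z"

lemma Li2_0 [simp]: "Li2 0 = 0"
  by (simp add: Li2_def)

lemma holomorphic_Li2: "Li2 holomorphic_on slit_plane"
  unfolding Li2_def using Li3_holomorphic open_slit_plane
  by (intro holomorphic_intros holomorphic_deriv)

lemma Li3_deriv:
  assumes "z \<in> slit_plane" "z \<noteq> 0"
  shows "(Li3 has_field_derivative Li2 z / z) (at z)"
  using holomorphic_derivI[OF Li3_holomorphic open_slit_plane assms(1)] assms(2)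
  by (simp add: Li2_def)

lemma Li3_sums:
  assumes "norm z < 1"
  shows "(\<lambda>k. 1 / of_nat (Suc k) ^ 3 * z ^ Suc k) sums Li3 z"
proof -
  have "summable (\<lambda>k. norm (1 / of_nat (Suc k) ^ 3 * z ^ Suc k))"
  proof (rule summable_comparison_test')
    show "summable (\<lambda>k. norm z ^ k)" using assms by (intro summable_geometric) auto
    fix k :: nat
    have "norm (1 / of_nat (Suc k) ^ 3 * z ^ Suc k) = norm z * norm z ^ k / real (Suc k) ^ 3"
      by (simp add: norm_mult norm_divide norm_power del: of_nat_Suc)
    also have "\<dots> \<le> norm z * norm z ^ k / 1"
      by (intro divide_left_mono) auto
    also have "\<dots> \<le> norm z ^ k" using assms by (simp add: mult_left_le_one_le)
    finally show "norm (norm (1 / of_nat (Suc k) ^ 3 * z ^ Suc k)) \<le> norm z ^ k" by simp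
  qed
  then have "summable (\<lambda>k. 1 / of_nat (Suc k) ^ 3 * z ^ Suc k)" by (rule summable_norm_cancel)
  then show ?thesis using assms by (simp add: Li3_eq_series summable_sums)
qed

lemma Li3_0 [simp]: "Li3 0 = 0"
  using Li3_eq_series[of 0] by simp

lemma Li2_sums:
  assumes "norm z < 1"
  shows "(\<lambda>k. 1 / of_nat (Suc k) ^ 2 * z ^ Suc k) sums Li2 z"
  using sums_times_deriv[OF holomorphic_on_subset[OF Li3_holomorphic ball_subset_slit_plane]
      Li3_sums assms]
  by (simp add: Li2_def power2_eq_square power3_eq_cube del: of_nat_Suc)

lemma Ln_one_minus_sums:
  assumes "norm z < 1"
  shows "(\<lambda>k. 1 / of_nat (Suc k) * z ^ Suc k) sums (- Ln (1 - z))"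
proof -
  have "(\<lambda>k. 1 / of_nat k * z ^ k) sums (- Ln (1 - z))"
    using sums_minus[OF Ln_series[of "-z"]] assms
    by (simp add: power_minus[of z] mult_ac flip: power_add)
  then show ?thesis by (subst sums_Suc_iff) simp
qed

text \<open>On the unit disc z d/dz turns the series of \<open>Li2\<close> into that of -Ln(1 - z);
  the identity theorem carries the equality to the whole slit plane.\<close>

lemma Li2_deriv:
  assumes z: "z \<in> slit_plane" "z \<noteq> 0"
  shows "(Li2 has_field_derivative - Ln (1 - z) / z) (at z)"
proof -
  have "z * deriv Li2 z = - Ln (1 - z)"
  proof (rule analytic_continuation_open[where s = "ball 0 1" and s' = slit_plane
        and f = "\<lambda>z. z * deriv Li2 z" and g = "\<lambda>z. - Ln (1 - z)"])
    show "connected slit_plane"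
      using starlike_slit_plane by (rule starlike_imp_connected)
    show "(\<lambda>z. z * deriv Li2 z) holomorphic_on slit_plane"
      using holomorphic_Li2 open_slit_plane by (intro holomorphic_intros holomorphic_deriv)
    show "(\<lambda>z. - Ln (1 - z)) holomorphic_on slit_plane"
      by (intro holomorphic_on_minus holomorphic_Ln_one_minus)
    fix u :: complex assume "u \<in> ball 0 1"
    then have u: "norm u < 1" by simp
    have "(\<lambda>k. of_nat (Suc k) * (1 / of_nat (Suc k) ^ 2) * u ^ Suc k) sums (u * deriv Li2 u)"
      by (rule sums_times_deriv[OF holomorphic_on_subset[OF holomorphic_Li2 ball_subset_slit_plane]
          Li2_sums u])
    moreover have "(\<lambda>k. of_nat (Suc k) * (1 / of_nat (Suc k) ^ 2) * u ^ Suc k) sums (- Ln (1 - u))"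
      using Ln_one_minus_sums[OF u] by (simp add: power2_eq_square del: of_nat_Suc)
    ultimately show "u * deriv Li2 u = - Ln (1 - u)" by (rule sums_unique2)
  qed (use z open_slit_plane ball_subset_slit_plane in auto)
  then show ?thesis
    using holomorphic_derivI[OF holomorphic_Li2 open_slit_plane z(1)] z(2)
    by (metis nonzero_mult_div_cancel_left)
qed

lemma cnj_Ln_one_minus: "z \<in> slit_plane \<Longrightarrow> Ln (1 - cnj z) = cnj (Ln (1 - z))"
  using cnj_Ln[OF one_minus_notin_nonpos_Reals] by simp

lemma Li2_cnj: "z \<in> slit_plane \<Longrightarrow> Li2 (cnj z) = cnj (Li2 z)"
  by (rule cnj_symmetric_primitive[OF holomorphic_Li2 Li2_0 Li2_deriv])
     (auto simp: cnj_Ln_one_minus)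

lemma Li3_cnj: "z \<in> slit_plane \<Longrightarrow> Li3 (cnj z) = cnj (Li3 z)"
  by (rule cnj_symmetric_primitive[OF Li3_holomorphic Li3_0 Li3_deriv])
     (auto simp: Li2_cnj)

section \<open>Landen's identity\<close>

lemma half_square_deriv:
  fixes f :: "complex \<Rightarrow> complex"
  assumes "(f has_field_derivative d) (at z)"
  shows "((\<lambda>z. (f z)\<^sup>2 / 2) has_field_derivative f z * d) (at z)"
  using assms by (auto intro!: derivative_eq_intros)

text \<open>The map z/(z - 1) fixes 0 and preserves the slit plane, so both sides are holomorphic
  there; they vanish at 0 and have equal derivatives.\<close>

lemma Landen:
  assumes "z \<in> slit_plane"
  shows "Li2 z + Li2 (z / (z - 1)) = - (Ln (1 - z))\<^sup>2 / 2"
proof -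
  \<comment> \<open>The map is its own inverse and sends the reals above 1 to themselves, so an
    image on the cut forces \<open>w\<close> onto the cut.\<close>
  have slit: "w / (w - 1) \<in> slit_plane" if w: "w \<in> slit_plane" for w
  proof -
    have "w \<noteq> 1" using w by (auto simp: slit_plane_iff)
    show ?thesis
    proof (rule ccontr)
      assume "w / (w - 1) \<notin> slit_plane"
      then obtain r where r: "w / (w - 1) = complex_of_real r" "r \<ge> 1"
        by (auto simp: slit_plane_def)
      then have "w = of_real r * (w - 1)" using \<open>w \<noteq> 1\<close> by (simp add: field_simps)
      then have "w * of_real (r - 1) = of_real r" by (simp add: algebra_simps)
      moreover have "r \<noteq> 1" using calculation by auto
      ultimately have "w = complex_of_real (r / (r - 1))" by (simp add: field_simps)
      moreover have "r / (r - 1) \<ge> 1" using r \<open>r \<noteq> 1\<close> by (simp add: field_simps)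
      ultimately show False using w by (simp add: slit_plane_iff)
    qed
  qed
  have "Li2 z + Li2 (z / (z - 1)) + (Ln (1 - z))\<^sup>2 / 2 = 0"
  proof (rule zero_on_slit_plane[where D = "\<lambda>z. Li2 z + Li2 (z / (z - 1)) + (Ln (1 - z))\<^sup>2 / 2"])
    have "Li2 \<circ> (\<lambda>z. z / (z - 1)) holomorphic_on slit_plane"
      by (rule holomorphic_on_compose_gen[OF _ holomorphic_Li2])
         (use slit in \<open>auto intro!: holomorphic_intros simp: slit_plane_iff\<close>)
    then show "(\<lambda>z. Li2 z + Li2 (z / (z - 1)) + (Ln (1 - z))\<^sup>2 / 2) holomorphic_on slit_plane"
      by (intro holomorphic_intros holomorphic_Li2 holomorphic_Ln_one_minus) (auto simp: o_def)
    fix w assume w: "w \<in> slit_plane" "w \<noteq> 0"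
    have w1: "w \<noteq> 1" using w by (auto simp: slit_plane_iff)
    \<comment> \<open>Since 1 - w/(w - 1) is the reciprocal of 1 - w, the inner logarithm is just
      the outer one with its sign changed.\<close>
    have "1 - w / (w - 1) = inverse (1 - w)" using w1 by (simp add: field_simps)
    then have Ln: "Ln (1 - w / (w - 1)) = - Ln (1 - w)"
      using Ln_inverse[OF one_minus_notin_nonpos_Reals[OF w(1)]] by simp
    have q: "((\<lambda>z. z / (z - 1)) has_field_derivative - (1 / (w - 1)\<^sup>2)) (at w)"
      using w1 by (auto intro!: derivative_eq_intros simp: power2_eq_square field_simps)
    have "((\<lambda>z. Li2 (z / (z - 1))) has_field_derivative
        (- Ln (1 - w / (w - 1)) / (w / (w - 1))) * (- (1 / (w - 1)\<^sup>2))) (at w)"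
      by (rule DERIV_chain2[OF Li2_deriv q]) (use slit w w1 in auto)
    moreover have "((\<lambda>z. (Ln (1 - z))\<^sup>2 / 2) has_field_derivative
        Ln (1 - w) * (- (1 / (1 - w)))) (at w)"
      by (rule half_square_deriv[OF Ln_one_minus_deriv[OF w(1)]])
    ultimately have "((\<lambda>z. Li2 z + Li2 (z / (z - 1)) + (Ln (1 - z))\<^sup>2 / 2) has_field_derivative
        - Ln (1 - w) / w + (- Ln (1 - w / (w - 1)) / (w / (w - 1))) * (- (1 / (w - 1)\<^sup>2))
        + Ln (1 - w) * (- (1 / (1 - w)))) (at w)"
      by (intro DERIV_add Li2_deriv w)
    \<comment> \<open>The logarithm is replaced by a free variable \<open>l\<close>, which leaves an
      identity of rational functions.\<close>
    moreover have "- l / w + (- (- l) / (w / (w - 1))) * (- (1 / (w - 1)\<^sup>2))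
        + l * (- (1 / (1 - w))) = 0" for l
    proof -
      define u where "u = w - 1"
      have u: "u \<noteq> 0" "w - 1 = u" "1 - w = - u" using w1 by (auto simp: u_def)
      have "- l / w + (- (- l) / (w / u)) * (- (1 / u\<^sup>2)) + l * (- (1 / - u))
          = l * (w - 1 - u) / (w * u)"
        using u(1) w(2) by (simp add: power2_eq_square divide_simps) (simp add: algebra_simps)
      then show ?thesis using u by simp
    qed
    ultimately show "((\<lambda>z. Li2 z + Li2 (z / (z - 1)) + (Ln (1 - z))\<^sup>2 / 2) has_field_derivative 0) (at w)"
      unfolding Ln by simp
  qed (use assms in auto)
  then show ?thesis by (simp add: eq_neg_iff_add_eq_0)
qed

section \<open>Logarithms and polylogarithms at -i and 1 + i\<close>

lemma Ln_minus_ii: "Ln (- \<i>) = - (\<i> * of_real (pi / 2))"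
  using cnj_Ln[of \<i>] by (simp add: complex_nonpos_Reals_iff)

lemma Ln_one_plus_ii: "Ln (1 + \<i>) = of_real (ln 2 / 2) + \<i> * of_real (pi / 4)"
proof (rule Ln_unique)
  have "exp (ln 2 / 2) = sqrt (2 :: real)"
    using powr_half_sqrt[of 2] by (simp add: powr_def)
  then have "exp (of_real (ln 2 / 2) + \<i> * of_real (pi / 4)) = of_real (sqrt 2) * cis (pi / 4)"
    by (simp only: exp_add cis_conv_exp exp_of_real)
  also have "\<dots> = 1 + \<i>"
    by (simp add: complex_eq_iff cos_45 sin_45)
  finally show "exp (of_real (ln 2 / 2) + \<i> * of_real (pi / 4)) = 1 + \<i>" .
qed auto

text \<open>The segment from 1/2 to -i avoids both the cut of \<open>w\<close> and that of
  \<open>1 - w\<close>. The endpoint 1/2 is where the functions below take real values; at -i the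
  reflected argument \<open>1 - w\<close> is 1 + i.\<close>

lemma constant_off_cuts:
  assumes F: "\<And>w. w \<in> slit_plane \<Longrightarrow> 1 - w \<in> slit_plane \<Longrightarrow> (F has_field_derivative 0) (at w)"
  shows "F (- \<i>) = F (1 / 2)"
proof -
  have "w \<in> slit_plane \<and> 1 - w \<in> slit_plane" if w: "w \<in> closed_segment (1 / 2) (- \<i>)" for w
  proof -
    obtain u where u: "0 \<le> u" "u \<le> 1" "w = (1 - u) *\<^sub>R (1 / 2) + u *\<^sub>R (- \<i>)"
      using w by (auto simp: in_segment)
    \<comment> \<open>The segment meets the real axis only at \<open>u = 0\<close>, where both
      \<open>w\<close> and \<open>1 - w\<close> equal 1/2.\<close>
    have "Re w = (1 - u) / 2" "Im w = - u" unfolding u(3) by simp_all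
    then show ?thesis using u by (auto simp: slit_plane_iff)
  qed
  then have "(F has_field_derivative 0) (at w within closed_segment (1 / 2) (- \<i>))"
    if "w \<in> closed_segment (1 / 2) (- \<i>)" for w
    using that F has_field_derivative_at_within by blast
  then obtain c where "\<And>w. w \<in> closed_segment (1 / 2) (- \<i>) \<Longrightarrow> F w = c"
    using has_field_derivative_zero_constant[OF convex_closed_segment] by metis
  from this[of "- \<i>"] this[of "1 / 2"] show ?thesis by simp
qed

text \<open>The condition on \<open>1 - w\<close> keeps \<open>w\<close> off the cut of
  \<open>Ln\<close>. The factor \<open>1 / (1 - w)\<close> stays separate so that later
  cancellations are polynomial in it.\<close>

lemma off_cuts_derivs:
  assumes "w \<in> slit_plane" "1 - w \<in> slit_plane"
  shows "w \<noteq> 0" "(Ln has_field_derivative 1 / w) (at w)"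
    "((\<lambda>w. Ln (1 - w)) has_field_derivative - (1 / (1 - w))) (at w)"
    "((\<lambda>w. Li2 (1 - w)) has_field_derivative Ln w * (1 / (1 - w))) (at w)"
    "((\<lambda>w. Li3 (1 - w)) has_field_derivative - (Li2 (1 - w) * (1 / (1 - w)))) (at w)"
proof -
  have w: "w \<noteq> 0" "1 - w \<noteq> 0" using assms by (auto simp: slit_plane_iff)
  show "w \<noteq> 0" by (rule w)
  show "(Ln has_field_derivative 1 / w) (at w)"
    using has_field_derivative_Ln[of w] one_minus_notin_nonpos_Reals[OF assms(2)]
    by (simp add: divide_inverse)
  show "((\<lambda>w. Ln (1 - w)) has_field_derivative - (1 / (1 - w))) (at w)"
    by (rule Ln_one_minus_deriv[OF assms(1)])
  have d: "((\<lambda>w. 1 - w) has_field_derivative - 1) (at w)"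
    by (auto intro!: derivative_eq_intros)
  show "((\<lambda>w. Li2 (1 - w)) has_field_derivative Ln w * (1 / (1 - w))) (at w)"
    using DERIV_chain2[OF Li2_deriv[OF assms(2) w(2)] d] by simp
  show "((\<lambda>w. Li3 (1 - w)) has_field_derivative - (Li2 (1 - w) * (1 / (1 - w)))) (at w)"
    using DERIV_chain2[OF Li3_deriv[OF assms(2) w(2)] d] by simp
qed

lemma real_at_half:
  assumes "F (cnj (1 / 2)) = cnj (F (1 / 2))"
  shows "Im (F (1 / 2)) = 0"
  using assms by (simp add: complex_eq_iff)

lemma half_in_slit_plane: "1 / 2 \<in> slit_plane"
  by (simp add: slit_plane_iff)

lemma Im_Ln_half: "Im (Ln (1 / 2)) = 0"
  using Ln_of_real[of "1 / 2"] by (simp add: Im_Ln_eq_0)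

lemma Im_Li2_half: "Im (Li2 (1 / 2)) = 0"
  by (rule real_at_half[of Li2]) (rule Li2_cnj[OF half_in_slit_plane])

lemma Im_Li3_half: "Im (Li3 (1 / 2)) = 0"
  by (rule real_at_half[of Li3]) (rule Li3_cnj[OF half_in_slit_plane])

text \<open>The reflection combination has zero derivative off the cuts and is real at 1/2, hence
  also at -i. This expresses the imaginary part of Li2(1 + i) through that of Li2(-i).\<close>

lemma Li2_reflection: "Im (Li2 (- \<i>) + Li2 (1 + \<i>) + Ln (- \<i>) * Ln (1 + \<i>)) = 0"
proof -
  define R where "R w = Li2 w + Li2 (1 - w) + Ln w * Ln (1 - w)" for w
  have "R (- \<i>) = R (1 / 2)"
  proof (rule constant_off_cuts)
    fix w assume w: "w \<in> slit_plane" "1 - w \<in> slit_plane"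
    note d = off_cuts_derivs[OF w]
    have "(R has_field_derivative - Ln (1 - w) / w + Ln w * (1 / (1 - w))
        + ((1 / w) * Ln (1 - w) + (- (1 / (1 - w))) * Ln w)) (at w)"
      unfolding R_def by (intro DERIV_add DERIV_mult d Li2_deriv w)
    then show "(R has_field_derivative 0) (at w)" by simp
  qed
  moreover have "Im (R (1 / 2)) = 0"
    by (simp add: R_def Im_Ln_half Im_Li2_half)
  ultimately show ?thesis by (simp add: R_def)
qed

text \<open>At z = 1 + i the two arguments in Landen's identity are conjugate, so its left side is
  twice the real part sought; the right side is -Ln(-i)^2/2 = pi^2/8.\<close>

lemma Re_Li2_one_plus_ii: "Re (Li2 (1 + \<i>)) = pi\<^sup>2 / 16"
proof -
  have "(1 + \<i>) / (1 + \<i> - 1) = cnj (1 + \<i>)"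
    by (simp add: complex_eq_iff Re_divide Im_divide)
  then have "Li2 (1 + \<i>) + cnj (Li2 (1 + \<i>)) = - (Ln (- \<i>))\<^sup>2 / 2"
    using Landen[OF one_plus_ii_in_slit_plane] Li2_cnj[OF one_plus_ii_in_slit_plane] by simp
  from arg_cong[OF this, of Re] show ?thesis
    by (simp add: Ln_minus_ii power2_eq_square)
qed

text \<open>Integrating Ln(1 - w)^2/w by parts twice, with Ln(w)/(1 - w) the derivative of Li2(1 -
  w), leads to the combination \<open>R\<close>. It is constant off the cuts and real at 1/2, so its
  imaginary part at -i vanishes.\<close>

lemma Im_primitive_at_minus_ii:
  assumes P: "P holomorphic_on slit_plane" "P 0 = 0"
    and P': "\<And>z. z \<in> slit_plane \<Longrightarrow> z \<noteq> 0 \<Longrightarrow> (P has_field_derivative (Ln (1 - z))\<^sup>2 / z) (at z)"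
  shows "Im (P (- \<i>)) = pi * (ln 2)\<^sup>2 / 8 + pi ^ 3 / 16 - ln 2 * Im (Li2 (- \<i>))
    - 2 * Im (Li3 (1 + \<i>))"
proof -
  define R where "R w = Ln w * (Ln (1 - w))\<^sup>2 + 2 * (Ln (1 - w) * Li2 (1 - w)) - 2 * Li3 (1 - w) - P w" for w
  have "R (- \<i>) = R (1 / 2)"
  proof (rule constant_off_cuts)
    fix w assume w: "w \<in> slit_plane" "1 - w \<in> slit_plane"
    note d = off_cuts_derivs[OF w]
    have sq: "((\<lambda>w. (Ln (1 - w))\<^sup>2) has_field_derivative 2 * (Ln (1 - w) * - (1 / (1 - w)))) (at w)"
      using DERIV_cmult[OF half_square_deriv[OF d(3)], of 2] by simp
    have "(R has_field_derivative (1 / w) * (Ln (1 - w))\<^sup>2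
        + 2 * (Ln (1 - w) * - (1 / (1 - w))) * Ln w
        + 2 * ((- (1 / (1 - w))) * Li2 (1 - w) + Ln w * (1 / (1 - w)) * Ln (1 - w))
        - 2 * (- (Li2 (1 - w) * (1 / (1 - w)))) - (Ln (1 - w))\<^sup>2 / w) (at w)"
      unfolding R_def by (intro DERIV_add DERIV_diff DERIV_cmult DERIV_mult d sq P' w)
    \<comment> \<open>Here \<open>l\<close> is Ln(1 - w), \<open>k\<close> is Ln(w),
      \<open>p\<close> is 1/(1 - w) and \<open>m\<close> is Li2(1 - w).\<close>
    moreover have "(1 / w) * l\<^sup>2 + 2 * (l * - p) * k + 2 * ((- p) * m + k * p * l) - 2 * (- (m * p))
        - l\<^sup>2 / w = 0" for l p k m :: complex
      by (simp add: algebra_simps)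
    ultimately show "(R has_field_derivative 0) (at w)" by metis
  qed
  moreover have "Im (P (1 / 2)) = 0"
    by (rule real_at_half[of P], rule cnj_symmetric_primitive[OF P P'])
       (auto simp: cnj_Ln_one_minus half_in_slit_plane)
  then have "Im (R (1 / 2)) = 0"
    by (simp add: R_def Im_Ln_half Im_Li2_half Im_Li3_half power2_eq_square)
  ultimately have "Im (Ln (- \<i>) * (Ln (1 + \<i>))\<^sup>2 + 2 * (Ln (1 + \<i>) * Li2 (1 + \<i>))
      - 2 * Li3 (1 + \<i>) - P (- \<i>)) = 0"
    by (simp add: R_def)
  \<comment> \<open>To be read with \<open>c\<close> = pi/2, \<open>l\<close>, \<open>m\<close>,
    \<open>t\<close> the values of Ln, Li2, Li3 at 1 + i, and \<open>p\<close> = P(-i).\<close>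
  moreover have "Im (- (\<i> * of_real c) * l\<^sup>2 + 2 * (l * m) - 2 * t - p)
      = - c * ((Re l)\<^sup>2 - (Im l)\<^sup>2) + 2 * (Re l * Im m + Im l * Re m) - 2 * Im t - Im p"
    for c l m t p
    by (simp add: power2_eq_square algebra_simps)
  moreover have L: "Re (Ln (1 + \<i>)) = ln 2 / 2" "Im (Ln (1 + \<i>)) = pi / 4"
    unfolding Ln_one_plus_ii by simp_all
  have "Im (Li2 (1 + \<i>)) = pi / 4 * ln 2 - Im (Li2 (- \<i>))"
    using Li2_reflection L by (simp add: Ln_minus_ii)
  ultimately have "- (pi / 2) * ((ln 2 / 2)\<^sup>2 - (pi / 4)\<^sup>2)
      + 2 * (ln 2 / 2 * (pi / 4 * ln 2 - Im (Li2 (- \<i>))) + pi / 4 * (pi\<^sup>2 / 16))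
      - 2 * Im (Li3 (1 + \<i>)) - Im (P (- \<i>)) = 0"
    unfolding Ln_minus_ii by (simp only: L Re_Li2_one_plus_ii)
  then have "Im (P (- \<i>)) = - (pi / 2) * ((ln 2 / 2)\<^sup>2 - (pi / 4)\<^sup>2)
      + 2 * (ln 2 / 2 * (pi / 4 * ln 2 - Im (Li2 (- \<i>))) + pi / 4 * (pi\<^sup>2 / 16))
      - 2 * Im (Li3 (1 + \<i>))" by linarith
  also have "\<dots> = pi * (ln 2)\<^sup>2 / 8 + pi ^ 3 / 16 - ln 2 * Im (Li2 (- \<i>)) - 2 * Im (Li3 (1 + \<i>))"
    by (simp add: power2_eq_square power3_eq_cube algebra_simps)
  finally show ?thesis .
qed

subsection \<open>Recurrences\<close>

text \<open>With t(k) = (-1)^k f(n + k), the k-th term is t(k) - t(k + 1), so the series telescopes.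
  In particular, two null sequences with the same \<open>r\<close> coincide.\<close>

lemma alternating_recurrence_sums:
  fixes f r :: "nat \<Rightarrow> real"
  assumes rec: "\<And>n. f n + f (Suc n) = r n" and lim: "f \<longlonglongrightarrow> 0"
  shows "(\<lambda>k. (-1) ^ k * r (n + k)) sums f n"
proof -
  define t where "t k = (-1) ^ k * f (n + k)" for k
  have "(\<lambda>k. norm (t k)) \<longlonglongrightarrow> 0"
    using tendsto_norm[OF LIMSEQ_ignore_initial_segment[OF lim, of n]]
    by (simp add: t_def abs_mult add.commute)
  then have "t \<longlonglongrightarrow> 0" by (simp only: tendsto_norm_zero_iff)
  then have "(\<lambda>k. t k - t (Suc k)) sums t 0"
    using telescope_sums'[of t 0] by simp
  then show ?thesis
    by (simp add: t_def rec[symmetric] algebra_simps)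
qed

lemma alternating_recurrence_tendsto_0:
  fixes f :: "nat \<Rightarrow> real"
  assumes rec: "\<And>n. f n + f (Suc n) = 4 / (2 * real n + 3)" and nonneg: "\<And>n. 0 \<le> f n"
  shows "f \<longlonglongrightarrow> 0"
proof (rule tendsto_sandwich[OF _ _ tendsto_const])
  show "\<forall>\<^sub>F n in sequentially. f n \<le> 4 * inverse (real (Suc n))"
  proof (rule always_eventually, rule allI)
    fix n
    have "f n \<le> 4 / (2 * real n + 3)" using rec[of n] nonneg[of "Suc n"] by linarith
    also have "\<dots> \<le> 4 / real (Suc n)" by (intro divide_left_mono) auto
    finally show "f n \<le> 4 * inverse (real (Suc n))" by (simp add: divide_inverse)
  qed
  show "(\<lambda>n. 4 * inverse (real (Suc n))) \<longlonglongrightarrow> 0"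
    using tendsto_mult_left[OF LIMSEQ_inverse_real_of_nat, of 4] by simp
qed (use nonneg in auto)

section \<open>The digamma differences\<close>

definition digamma_gap :: "nat \<Rightarrow> real" where
  "digamma_gap n = Digamma ((2 * real n + 5) / 4) - Digamma ((2 * real n + 3) / 4)"

text \<open>With x = (2n + 3)/4 the two gaps are psi(x + 1/2) - psi(x) and psi(x + 1) - psi(x +
  1/2), which add up to 1/x.\<close>

lemma digamma_gap_rec: "digamma_gap n + digamma_gap (Suc n) = 4 / (2 * real n + 3)"
proof -
  define x where "x = (2 * real n + 3) / 4"
  have "x > 0" by (simp add: x_def)
  then have "Digamma (x + 1) = Digamma x + 1 / x" by (intro Digamma_plus1) auto
  moreover have "(2 * real (Suc n) + 5) / 4 = x + 1" "(2 * real (Suc n) + 3) / 4 = (2 * real n + 5) / 4"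
    by (simp_all add: x_def field_simps)
  ultimately have "digamma_gap n + digamma_gap (Suc n) = 1 / x"
    unfolding digamma_gap_def x_def[symmetric] by (simp only:)
  then show ?thesis by (simp add: x_def)
qed

lemma digamma_gap_nonneg: "digamma_gap n \<ge> 0"
  unfolding digamma_gap_def diff_ge_0_iff_ge
  by (rule Polygamma_real_mono) (auto simp: field_simps)

lemma digamma_gap_sums:
  "(\<lambda>k. (-1) ^ k * (4 / (2 * real (n + k) + 3))) sums digamma_gap n"
  by (rule alternating_recurrence_sums[OF digamma_gap_rec
        alternating_recurrence_tendsto_0[OF digamma_gap_rec digamma_gap_nonneg]])

lemma Leibniz_sums: "(\<lambda>k. (-1) ^ k / (2 * real k + 1)) sums (pi / 4)"
proof -
  have "summable (\<lambda>k. (-1) ^ k * 1 / real (k * 2 + 1))"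
    using summable_arctan_series[of 1] by simp
  from summable_sums[OF this] show ?thesis
    unfolding pi_series[symmetric] by (simp add: mult.commute add.commute)
qed

text \<open>The alternating series of the gap at 0 is the Leibniz series without its first term,
  scaled by -4.\<close>

lemma digamma_gap_0: "digamma_gap 0 = 4 - pi"
proof -
  have "(\<lambda>k. (-1) ^ Suc k / (2 * real (Suc k) + 1)) sums (pi / 4 - 1)"
    using Leibniz_sums by (subst sums_Suc_iff) simp
  then have "(\<lambda>k. (-4) * ((-1) ^ Suc k / (2 * real (Suc k) + 1))) sums ((-4) * (pi / 4 - 1))"
    by (rule sums_mult)
  moreover have "(\<lambda>k. (-4) * ((-1) ^ Suc k / (2 * real (Suc k) + 1)))
      = (\<lambda>k. (-1) ^ k * (4 / (2 * real (0 + k) + 3)))"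
    by (auto simp: algebra_simps)
  ultimately have "(\<lambda>k. (-1) ^ k * (4 / (2 * real (0 + k) + 3))) sums (4 - pi)"
    by simp
  then show ?thesis using digamma_gap_sums[of 0] sums_unique2 by blast
qed

lemma digamma_gap_closed_form:
  "digamma_gap n = (-1) ^ n * (4 * (\<Sum>j = 0..n. (-1) ^ j / (2 * real j + 1)) - pi)"
proof (induction n)
  case (Suc n)
  have "digamma_gap (Suc n) = 4 / (2 * real n + 3) - digamma_gap n"
    using digamma_gap_rec[of n] by simp
  then show ?case unfolding Suc by (simp add: algebra_simps)
qed (simp add: digamma_gap_0)

section \<open>The full sum and its recurrences\<close>

text \<open>The sum with its $k = 0$ term included.\<close>
definition Theta2_full :: "nat \<Rightarrow> real" where
  "Theta2_full n = (\<Sum>k. (-1) ^ k / (2 * real k + 1)\<^sup>2 * digamma_gap (n + k))"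

lemma Theta2_term_eq: "Theta2_term n k = (-1) ^ k / (2 * real k + 1)\<^sup>2 * digamma_gap (n + k)"
  by (simp add: Theta2_term_def digamma_gap_def add_ac)

lemma Theta2_full_sums:
  "(\<lambda>k. (-1) ^ k / (2 * real k + 1)\<^sup>2 * digamma_gap (n + k)) sums Theta2_full n"
  using Theta2_summable[of n] summable_Suc_iff[of "Theta2_term n"]
  unfolding Theta2_term_eq Theta2_full_def by (intro summable_sums) blast

lemma Theta2_at_1_eq: "Theta2_at_1 n = Theta2_full n - digamma_gap n"
proof -
  have "Theta2_term n sums Theta2_full n"
    using Theta2_full_sums[of n] by (simp add: Theta2_term_eq[abs_def])
  then have "(\<lambda>k. Theta2_term n (Suc k)) sums (Theta2_full n - Theta2_term n 0)"
    by (subst sums_Suc_iff) simp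
  then show ?thesis
    unfolding Theta2_at_1_def by (simp add: sums_iff Theta2_term_eq)
qed

lemma catalan_sums: "(\<lambda>k. (-1) ^ k / (2 * real k + 1)\<^sup>2) sums catalan"
  unfolding catalan_def using catalan_summable by (rule summable_sums)

text \<open>Adding neighbouring sums replaces the gaps by 4/v with v = u + 2a, u = 2k + 1, a = n +
  1. Partial fractions of 4/(u^2 v) then split the series into those for Catalan's constant, for
  pi/4 and for the gap at n.\<close>

lemma Theta2_full_rec:
  "Theta2_full n + Theta2_full (Suc n)
     = 2 * catalan / (real n + 1) + (digamma_gap n - pi) / (4 * (real n + 1)\<^sup>2)"
proof -
  define a where "a = real n + 1"
  have a: "a > 0" by (simp add: a_def)
  have "(\<lambda>k. (-1) ^ k / (2 * real k + 1)\<^sup>2 * digamma_gap (n + k)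
      + (-1) ^ k / (2 * real k + 1)\<^sup>2 * digamma_gap (Suc n + k))
      sums (Theta2_full n + Theta2_full (Suc n))"
    by (intro sums_add Theta2_full_sums)
  moreover have "(-1) ^ k / (2 * real k + 1)\<^sup>2 * digamma_gap (n + k)
      + (-1) ^ k / (2 * real k + 1)\<^sup>2 * digamma_gap (Suc n + k)
      = 2 / a * ((-1) ^ k / (2 * real k + 1)\<^sup>2) - 1 / a\<^sup>2 * ((-1) ^ k / (2 * real k + 1))
        + 1 / (4 * a\<^sup>2) * ((-1) ^ k * (4 / (2 * real (n + k) + 3)))" for k
  proof -
    define u where "u = 2 * real k + 1"
    have u: "u > 0" by (simp add: u_def)
    \<comment> \<open>\<open>v\<close> stays an atom while fractions are combined; substituting it
      afterwards collapses the numerator to 4a^2.\<close>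
    have *: "4 / (u\<^sup>2 * v) = 2 / a / u\<^sup>2 - 1 / a\<^sup>2 / u + 1 / (4 * a\<^sup>2) * (4 / v)"
      if v: "v = u + 2 * a" for v
    proof -
      have "v > 0" using u a v by simp
      then have "2 / a / u\<^sup>2 - 1 / a\<^sup>2 / u + 1 / (4 * a\<^sup>2) * (4 / v)
          = (2 * a * v - u * v + u\<^sup>2) / (a\<^sup>2 * (u\<^sup>2 * v))"
        using u a by (simp add: add_divide_distrib diff_divide_distrib power2_eq_square)
      also have "2 * a * v - u * v + u\<^sup>2 = a\<^sup>2 * 4"
        by (simp add: v algebra_simps power2_eq_square)
      also have "a\<^sup>2 * 4 / (a\<^sup>2 * (u\<^sup>2 * v)) = 4 / (u\<^sup>2 * v)"
        using a by simp
      finally show ?thesis ..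
    qed
    have dist: "s * (b / p - c / q + d * t) = b * (s / p) - c * (s / q) + d * (s * t)"
      for s b c d p q t :: real by (simp add: algebra_simps)
    have eq: "2 * real (n + k) + 3 = u + 2 * a" by (simp add: u_def a_def)
    have "(-1) ^ k / u\<^sup>2 * digamma_gap (n + k) + (-1) ^ k / u\<^sup>2 * digamma_gap (Suc n + k)
        = (-1) ^ k * (1 / u\<^sup>2 * (digamma_gap (n + k) + digamma_gap (Suc (n + k))))"
      by (simp add: algebra_simps)
    also have "\<dots> = (-1) ^ k * (4 / (u\<^sup>2 * (u + 2 * a)))"
      unfolding digamma_gap_rec eq by simp
    also have "\<dots> = 2 / a * ((-1) ^ k / u\<^sup>2) - 1 / a\<^sup>2 * ((-1) ^ k / u)
        + 1 / (4 * a\<^sup>2) * ((-1) ^ k * (4 / (u + 2 * a)))"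
      unfolding *[OF refl] by (rule dist)
    finally show ?thesis unfolding eq u_def .
  qed
  ultimately have "(\<lambda>k. 2 / a * ((-1) ^ k / (2 * real k + 1)\<^sup>2)
      - 1 / a\<^sup>2 * ((-1) ^ k / (2 * real k + 1))
      + 1 / (4 * a\<^sup>2) * ((-1) ^ k * (4 / (2 * real (n + k) + 3))))
      sums (Theta2_full n + Theta2_full (Suc n))" by simp
  moreover have "(\<lambda>k. 2 / a * ((-1) ^ k / (2 * real k + 1)\<^sup>2)
      - 1 / a\<^sup>2 * ((-1) ^ k / (2 * real k + 1))
      + 1 / (4 * a\<^sup>2) * ((-1) ^ k * (4 / (2 * real (n + k) + 3))))
      sums (2 / a * catalan - 1 / a\<^sup>2 * (pi / 4) + 1 / (4 * a\<^sup>2) * digamma_gap n)"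
    by (intro sums_add sums_diff sums_mult catalan_sums Leibniz_sums digamma_gap_sums)
  ultimately have "Theta2_full n + Theta2_full (Suc n)
      = 2 / a * catalan - 1 / a\<^sup>2 * (pi / 4) + 1 / (4 * a\<^sup>2) * digamma_gap n"
    by (rule sums_unique2)
  also have "\<dots> = 2 * catalan / a + (digamma_gap n - pi) / (4 * a\<^sup>2)"
    using a by (simp add: field_simps)
  finally show ?thesis unfolding a_def .
qed

text \<open>The recurrences at 2p and 2p + 1 are subtracted to eliminate the odd index. The weights
  1/(2x)^2 and 1/(2x - 1)^2 of the inner sum combine to the numerator 8x^2 - 4x + 1 = (2x - 1)^2 +
  (2x)^2, where x = p + 1.\<close>

lemma Theta2_full_even:
  "Theta2_full (2 * p) = Theta2_full 0
     + 1/4 * (\<Sum>j = 1..p. 1 / ((real j)\<^sup>2 * (4 * real j - 1)))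
     - 1/4 * (\<Sum>k = 1..p. \<Sum>j = 0..2 * k - 2.
             (-1) ^ j * (8 * (real k)\<^sup>2 - 4 * real k + 1)
               / ((real k)\<^sup>2 * (2 * real j + 1) * (2 * real k - 1)\<^sup>2))
     + 1/2 * (\<Sum>j = 1..p. 1 / (2 * real j - 1)\<^sup>2) * pi
     - catalan * (\<Sum>j = 1..p. 1 / (real j * (2 * real j - 1)))"
proof (induction p)
  case (Suc p)
  define x where "x = real (Suc p)"
  have x: "x \<ge> 1" by (simp add: x_def)
  define D where "D = (\<Sum>j = 0..2 * p. (-1) ^ j / (2 * real j + 1) :: real)"
  have inner: "(\<Sum>j = 0..2 * Suc p - 2. (-1) ^ j * (8 * x\<^sup>2 - 4 * x + 1)
      / (x\<^sup>2 * (2 * real j + 1) * (2 * x - 1)\<^sup>2))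
      = (8 * x\<^sup>2 - 4 * x + 1) / (x\<^sup>2 * (2 * x - 1)\<^sup>2) * D"
    unfolding D_def sum_distrib_left by (intro sum.cong) (simp_all add: field_simps)
  have g0: "digamma_gap (2 * p) = 4 * D - pi"
    unfolding D_def digamma_gap_closed_form[of "2 * p"] by simp
  have xp: "2 * x - 1 = real (2 * p) + 1" "2 * x = real (Suc (2 * p)) + 1"
    by (simp_all add: x_def)
  \<comment> \<open>The odd-indexed gap is obtained from the even one, so that both involve the same
    partial sum \<open>D\<close>.\<close>
  have g1: "digamma_gap (Suc (2 * p)) = 4 / (4 * x - 1) - (4 * D - pi)"
    using digamma_gap_rec[of "2 * p"] g0 by (simp add: x_def algebra_simps)
  have "Theta2_full (2 * p) + Theta2_full (Suc (2 * p))
      = 2 * catalan / (2 * x - 1) + (4 * D - pi - pi) / (4 * (2 * x - 1)\<^sup>2)"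
    using Theta2_full_rec[of "2 * p"] unfolding g0 xp(1)[symmetric] .
  moreover have "Theta2_full (Suc (2 * p)) + Theta2_full (2 * Suc p)
      = 2 * catalan / (2 * x) + (4 / (4 * x - 1) - (4 * D - pi) - pi) / (4 * (2 * x)\<^sup>2)"
    using Theta2_full_rec[of "Suc (2 * p)"] unfolding g1 xp(2)[symmetric] by simp
  ultimately have "Theta2_full (2 * Suc p) = Theta2_full (2 * p)
      + (2 * catalan / (2 * x) + (4 / (4 * x - 1) - (4 * D - pi) - pi) / (4 * (2 * x)\<^sup>2))
      - (2 * catalan / (2 * x - 1) + (4 * D - pi - pi) / (4 * (2 * x - 1)\<^sup>2))"
    by linarith
  also have "\<dots> = Theta2_full (2 * p)
      + 1/4 * (1 / (x\<^sup>2 * (4 * x - 1)))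
      - 1/4 * ((8 * x\<^sup>2 - 4 * x + 1) / (x\<^sup>2 * (2 * x - 1)\<^sup>2) * D)
      + 1/2 * (1 / (2 * x - 1)\<^sup>2) * pi - catalan * (1 / (x * (2 * x - 1)))"
  proof -
    have e1: "2 * catalan / (2 * x) - 2 * catalan / (2 * x - 1) = - (catalan * (1 / (x * (2 * x - 1))))"
      using x by (simp add: field_simps)
    have "(4 / z - (4 * D - pi) - pi) / (4 * (2 * x)\<^sup>2) = 1/4 * (1 / (x\<^sup>2 * z)) - D / (4 * x\<^sup>2)"
      if "z > 0" for z
      using x that by (simp add: field_simps power2_eq_square)
    then have e2: "(4 / (4 * x - 1) - (4 * D - pi) - pi) / (4 * (2 * x)\<^sup>2)
        = 1/4 * (1 / (x\<^sup>2 * (4 * x - 1))) - D / (4 * x\<^sup>2)"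
      using x by simp
    have e3: "(4 * D - pi - pi) / (4 * (2 * x - 1)\<^sup>2)
        = D / (2 * x - 1)\<^sup>2 - 1/2 * (1 / (2 * x - 1)\<^sup>2) * pi"
      by (simp add: diff_divide_distrib)
    define y where "y = 2 * x - 1"
    have y: "y > 0" "8 * x\<^sup>2 - 4 * x + 1 = y\<^sup>2 + 4 * x\<^sup>2"
      using x by (simp_all add: y_def power2_eq_square algebra_simps)
    have e4: "D / (4 * x\<^sup>2) + D / (2 * x - 1)\<^sup>2
        = 1/4 * ((8 * x\<^sup>2 - 4 * x + 1) / (x\<^sup>2 * (2 * x - 1)\<^sup>2) * D)"
      unfolding y(2) y_def[symmetric] using x y(1) by (simp add: field_simps)
    show ?thesis using e1 e2 e3 e4 by linarith
  qed
  finally show ?case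
    using inner unfolding Suc x_def by (simp add: algebra_simps)
qed simp

text \<open>The same elimination with the even index 2p + 2 in the middle; now 8x^2 + 4x + 1 = (2x +
  1)^2 + (2x)^2.\<close>

lemma Theta2_full_odd:
  "Theta2_full (2 * p + 1) = Theta2_full 1
     - (\<Sum>j = 1..p. 1 / (4 * (real j)\<^sup>2 * (4 * real j + 1)))
     + 1/4 * (\<Sum>k = 1..p. \<Sum>j = 0..2 * k.
             (-1) ^ j * (8 * (real k)\<^sup>2 + 4 * real k + 1)
               / ((real k)\<^sup>2 * (2 * real j + 1) * (2 * real k + 1)\<^sup>2))
     - (\<Sum>j = 1..p. 1 / (real j * (2 * real j + 1))) * catalan
     - (\<Sum>j = 1..p. 1 / (2 * real j + 1)\<^sup>2) * (pi / 2)"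
proof (induction p)
  case (Suc p)
  define x where "x = real (Suc p)"
  have x: "x \<ge> 1" by (simp add: x_def)
  define D where "D = (\<Sum>j = 0..2 * Suc p. (-1) ^ j / (2 * real j + 1) :: real)"
  have inner: "(\<Sum>j = 0..2 * Suc p. (-1) ^ j * (8 * x\<^sup>2 + 4 * x + 1)
      / (x\<^sup>2 * (2 * real j + 1) * (2 * x + 1)\<^sup>2))
      = (8 * x\<^sup>2 + 4 * x + 1) / (x\<^sup>2 * (2 * x + 1)\<^sup>2) * D"
    unfolding D_def sum_distrib_left by (intro sum.cong) (simp_all add: field_simps)
  have g1: "digamma_gap (2 * Suc p) = 4 * D - pi"
    unfolding D_def digamma_gap_closed_form[of "2 * Suc p"] by simp
  have xp: "2 * x = real (2 * p + 1) + 1" "2 * x + 1 = real (2 * Suc p) + 1"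
    by (simp_all add: x_def)
  \<comment> \<open>The recurrence is run backwards from index 2p + 2, again to share
    \<open>D\<close>.\<close>
  have g0: "digamma_gap (2 * p + 1) = 4 / (4 * x + 1) - (4 * D - pi)"
    using digamma_gap_rec[of "2 * p + 1"] g1 by (simp add: x_def algebra_simps)
  have "Theta2_full (2 * p + 1) + Theta2_full (2 * Suc p)
      = 2 * catalan / (2 * x) + (4 / (4 * x + 1) - (4 * D - pi) - pi) / (4 * (2 * x)\<^sup>2)"
    using Theta2_full_rec[of "2 * p + 1"] unfolding g0 xp(1)[symmetric] by simp
  moreover have "Theta2_full (2 * Suc p) + Theta2_full (2 * Suc p + 1)
      = 2 * catalan / (2 * x + 1) + (4 * D - pi - pi) / (4 * (2 * x + 1)\<^sup>2)"
    using Theta2_full_rec[of "2 * Suc p"] unfolding g1 xp(2)[symmetric] by simp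
  ultimately have "Theta2_full (2 * Suc p + 1) = Theta2_full (2 * p + 1)
      - (2 * catalan / (2 * x) + (4 / (4 * x + 1) - (4 * D - pi) - pi) / (4 * (2 * x)\<^sup>2))
      + (2 * catalan / (2 * x + 1) + (4 * D - pi - pi) / (4 * (2 * x + 1)\<^sup>2))"
    by linarith
  also have "\<dots> = Theta2_full (2 * p + 1)
      - 1 / (4 * x\<^sup>2 * (4 * x + 1))
      + 1/4 * ((8 * x\<^sup>2 + 4 * x + 1) / (x\<^sup>2 * (2 * x + 1)\<^sup>2) * D)
      - 1 / (x * (2 * x + 1)) * catalan - 1 / (2 * x + 1)\<^sup>2 * (pi / 2)"
  proof -
    have e1: "2 * catalan / (2 * x) - 2 * catalan / (2 * x + 1) = 1 / (x * (2 * x + 1)) * catalan"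
      using x by (simp add: field_simps)
    have "(4 / z - (4 * D - pi) - pi) / (4 * (2 * x)\<^sup>2) = 1 / (4 * x\<^sup>2 * z) - D / (4 * x\<^sup>2)"
      if "z > 0" for z
      using x that by (simp add: field_simps power2_eq_square)
    then have e2: "(4 / (4 * x + 1) - (4 * D - pi) - pi) / (4 * (2 * x)\<^sup>2)
        = 1 / (4 * x\<^sup>2 * (4 * x + 1)) - D / (4 * x\<^sup>2)"
      using x by simp
    have e3: "(4 * D - pi - pi) / (4 * (2 * x + 1)\<^sup>2)
        = D / (2 * x + 1)\<^sup>2 - 1 / (2 * x + 1)\<^sup>2 * (pi / 2)"
      by (simp add: diff_divide_distrib)
    define y where "y = 2 * x + 1"
    have y: "y > 0" "8 * x\<^sup>2 + 4 * x + 1 = y\<^sup>2 + 4 * x\<^sup>2"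
      using x by (simp_all add: y_def power2_eq_square algebra_simps)
    have e4: "D / (4 * x\<^sup>2) + D / (2 * x + 1)\<^sup>2
        = 1/4 * ((8 * x\<^sup>2 + 4 * x + 1) / (x\<^sup>2 * (2 * x + 1)\<^sup>2) * D)"
      unfolding y(2) y_def[symmetric] using x y(1) by (simp add: field_simps)
    show ?thesis using e1 e2 e3 e4 by linarith
  qed
  finally show ?case
    using inner unfolding Suc x_def by (simp add: algebra_simps)
qed simp

lemma Theta2_full_1: "Theta2_full 1 = 2 * catalan + 1 - pi / 2 - Theta2_full 0"
  using Theta2_full_rec[of 0] by (simp add: digamma_gap_0 field_simps)

subsection \<open>The initial value\<close>

lemma rotated_in_slit_plane: "- (\<i> * of_real x) \<in> slit_plane"
  by (simp add: slit_plane_iff)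

text \<open>This is the series of the inverse tangent integral Ti_2(x): at -ix the even powers are
  real and drop out of the imaginary part.\<close>

lemma Im_Li2_sums:
  assumes "0 \<le> x" "x < 1"
  shows "(\<lambda>k. (-1) ^ k * x ^ (2 * k + 1) / (2 * real k + 1)\<^sup>2) sums (- Im (Li2 (- (\<i> * of_real x))))"
proof -
  define z where "z = - (\<i> * complex_of_real x)"
  define f where "f n = - Im (1 / of_nat (Suc n) ^ 2 * z ^ Suc n)" for n
  have z2: "z ^ (2 * k) = of_real ((-1) ^ k * x ^ (2 * k))" for k
    by (simp add: z_def power_mult power_mult_distrib power_minus[of "(complex_of_real x)\<^sup>2"])
  have "norm z < 1" using assms by (simp add: z_def norm_mult)
  then have "f sums - Im (Li2 z)"
    unfolding f_def by (intro sums_minus sums_Im Li2_sums)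
  \<comment> \<open>Because \<open>f n\<close> carries the exponent \<open>Suc n\<close>, the
    indices outside the range are the odd ones, belonging to even powers.\<close>
  moreover have "f n = 0" if "n \<notin> range (\<lambda>k. 2 * k)" for n
  proof -
    have "even (Suc n)" using that by (auto elim!: evenE)
    then obtain k where k: "Suc n = 2 * k" by (elim evenE)
    have "1 / of_nat (Suc n) ^ 2 * z ^ Suc n = of_real (1 / real (Suc n) ^ 2 * ((-1) ^ k * x ^ (2 * k)))"
      unfolding k z2 by simp
    then show ?thesis unfolding f_def by (simp only: Im_complex_of_real minus_zero)
  qed
  ultimately have "(\<lambda>k. f (2 * k)) sums - Im (Li2 z)"
    by (subst sums_mono_reindex) (auto simp: strict_mono_def)
  moreover have "f (2 * k) = (-1) ^ k * x ^ (2 * k + 1) / (2 * real k + 1)\<^sup>2" for k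
  proof -
    have "1 / of_nat (Suc (2 * k)) ^ 2 * z ^ Suc (2 * k)
        = of_real (- ((-1) ^ k * x ^ (2 * k + 1) / (2 * real k + 1)\<^sup>2)) * \<i>"
      unfolding power_Suc z2 by (simp add: z_def add.commute)
    moreover have "Im (of_real r * \<i>) = r" for r by simp
    ultimately show ?thesis unfolding f_def by (simp only: minus_minus)
  qed
  ultimately show ?thesis by (simp add: z_def)
qed

lemma summable_four_over_odd_squares: "summable (\<lambda>k. 4 / (2 * real k + 1)\<^sup>2)"
  using summable_mult[OF summable_inverse_odd_squares, of 4] by simp

lemma continuous_on_rotated:
  assumes "F holomorphic_on slit_plane"
  shows "continuous_on A (\<lambda>x. F (- (\<i> * of_real x)))"
  by (rule continuous_on_compose2[OF holomorphic_on_imp_continuous_on[OF assms]])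
     (auto intro!: continuous_intros rotated_in_slit_plane)

text \<open>Includes the endpoint x = 1, on the boundary of the disc: the series converges
  uniformly, so both sides are continuous and agree on the closure of [0,1). At x = 1 it yields
  Catalan's constant.\<close>

lemma Im_Li2_suminf:
  assumes "x \<in> {0..1}"
  shows "(\<Sum>k. (-1) ^ k * x ^ (2 * k + 1) / (2 * real k + 1)\<^sup>2) = - Im (Li2 (- (\<i> * of_real x)))"
proof -
  define T where "T x = (\<Sum>k. (-1) ^ k * x ^ (2 * k + 1) / (2 * real k + 1)\<^sup>2)" for x :: real
  have "uniform_limit {0..1} (\<lambda>n x. \<Sum>k<n. (-1) ^ k * x ^ (2 * k + 1) / (2 * real k + 1)\<^sup>2) T sequentially"
    unfolding T_def
  proof (rule Weierstrass_m_test)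
    fix k and x :: real assume x: "x \<in> {0..1}"
    then have "x ^ (2 * k + 1) \<le> 1" by (intro power_le_one) auto
    then show "norm ((-1) ^ k * x ^ (2 * k + 1) / (2 * real k + 1)\<^sup>2) \<le> 1 / (2 * real k + 1)\<^sup>2"
      using x by (simp add: abs_mult divide_right_mono)
  qed (rule summable_inverse_odd_squares)
  then have "continuous_on {0..1} T"
    by (rule uniform_limit_theorem[rotated]) (auto intro!: always_eventually continuous_intros)
  then have "continuous_on (closure {0..<1}) (\<lambda>x. T x + Im (Li2 (- (\<i> * of_real x))))"
    by (auto intro!: continuous_intros continuous_on_rotated holomorphic_Li2)
  then have "T x + Im (Li2 (- (\<i> * of_real x))) = 0"
    by (rule continuous_constant_on_closure) (use assms Im_Li2_sums in \<open>auto simp: T_def sums_iff\<close>)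
  then show ?thesis by (simp add: T_def)
qed

lemma Im_Li2_minus_ii: "Im (Li2 (- \<i>)) = - catalan"
  using Im_Li2_suminf[of 1] by (simp add: catalan_def)

text \<open>The integrals satisfy the recurrence of the gaps, because the factor 1 + x^2 cancels in
  the sum of two neighbours. Being nonnegative, they tend to 0, and a null sequence with this
  recurrence is unique.\<close>

lemma digamma_gap_integral:
  "((\<lambda>x. 4 * x ^ (2 * k + 2) / (1 + x\<^sup>2)) has_integral digamma_gap k) {0..1}"
proof -
  define f where "f k x = 4 * x ^ (2 * k + 2) / (1 + x\<^sup>2)" for k and x :: real
  define C where "C k = integral {0..1} (f k)" for k
  have nz: "1 + x\<^sup>2 \<noteq> 0" for x :: real
    by (metis add_pos_nonneg less_irrefl zero_le_power2 zero_less_one)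
  have f: "(f k has_integral C k) {0..1}" for k
    unfolding C_def f_def
    by (intro integrable_integral integrable_continuous_interval continuous_intros) (auto simp: nz)
  have rec: "C k + C (Suc k) = 4 / (2 * real k + 3)" for k
  proof (rule has_integral_unique)
    show "((\<lambda>x. f k x + f (Suc k) x) has_integral C k + C (Suc k)) {0..1}"
      by (intro has_integral_add f)
    have "((\<lambda>x. 4 * x ^ (2 * k + 2)) has_integral
        4 / (2 * real k + 3) * 1 ^ (2 * k + 3) - 4 / (2 * real k + 3) * 0 ^ (2 * k + 3)) {0..1}"
    proof (rule fundamental_theorem_of_calculus)
      fix x :: real
      have "((\<lambda>x. 4 / (2 * real k + 3) * x ^ (2 * k + 3)) has_real_derivative
          4 / (2 * real k + 3) * (real (2 * k + 3) * x ^ (2 * k + 2))) (at x within {0..1})"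
        by (rule DERIV_cmult, rule DERIV_cong[OF DERIV_pow]) simp
      moreover have "4 / (2 * real k + 3) * (real (2 * k + 3) * x ^ (2 * k + 2)) = 4 * x ^ (2 * k + 2)"
        by simp
      ultimately show "((\<lambda>x. 4 / (2 * real k + 3) * x ^ (2 * k + 3)) has_vector_derivative
          4 * x ^ (2 * k + 2)) (at x within {0..1})"
        unfolding has_real_derivative_iff_has_vector_derivative[symmetric] by simp
    qed simp
    moreover have "f k x + f (Suc k) x = 4 * x ^ (2 * k + 2)" for x
    proof -
      have "f k x + f (Suc k) x = 4 * x ^ (2 * k + 2) * (1 + x\<^sup>2) / (1 + x\<^sup>2)"
        by (simp add: f_def add_divide_distrib[symmetric] power_add algebra_simps power2_eq_square)
      then show ?thesis using nz by simp
    qed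
    ultimately show "((\<lambda>x. f k x + f (Suc k) x) has_integral 4 / (2 * real k + 3)) {0..1}"
      by (simp add: power_0_left)
  qed
  have "C k \<ge> 0" for k
    by (rule has_integral_nonneg[OF f]) (simp add: f_def)
  then have "C \<longlonglongrightarrow> 0"
    by (intro alternating_recurrence_tendsto_0 rec)
  then have "C k = digamma_gap k"
    using alternating_recurrence_sums[of C "\<lambda>k. 4 / (2 * real k + 3)", OF rec] digamma_gap_sums sums_unique2 by blast
  then show ?thesis using f[of k] unfolding f_def[abs_def] by simp
qed

text \<open>The path -ix has velocity -i, and Im(-i c) = -Re c.\<close>

lemma rotated_Im_deriv:
  assumes F: "(F has_field_derivative c) (at (- (\<i> * of_real x)))"
  shows "((\<lambda>x. Im (F (- (\<i> * of_real x)))) has_real_derivative - Re c) (at x)"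
proof -
  have "((\<lambda>x. - (\<i> * of_real x)) has_vector_derivative - \<i>) (at x)"
    by (auto intro!: derivative_eq_intros)
  then have "(F \<circ> (\<lambda>x. - (\<i> * of_real x)) has_vector_derivative (- \<i>) * c) (at x)"
    using F by (rule field_vector_diff_chain_at)
  then have "((\<lambda>x. Im (F (- (\<i> * of_real x)))) has_vector_derivative Im ((- \<i>) * c)) (at x)"
    using bounded_linear.has_vector_derivative[OF bounded_linear_Im] by (fastforce simp: o_def)
  then show ?thesis
    by (simp add: has_real_derivative_iff_has_vector_derivative)
qed

text \<open>Summation under the integral gives the integrand 4x Ti_2(x)/(1 + x^2). Integrating by
  parts against 2 ln(1 + x^2) leaves an integral that the imaginary part of P(-ix)
  evaluates.\<close>

lemma Theta2_full_0_integral: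
  assumes P: "P holomorphic_on slit_plane" "P 0 = 0"
    and P': "\<And>z. z \<in> slit_plane \<Longrightarrow> z \<noteq> 0 \<Longrightarrow> (P has_field_derivative (Ln (1 - z))\<^sup>2 / z) (at z)"
  shows "Theta2_full 0 = 2 * ln 2 * catalan - 2 * Im (P (- \<i>))"
proof -
  define V where "V x = Im (Li2 (- (\<i> * of_real x)))" for x
  define W where "W x = Im (P (- (\<i> * of_real x)))" for x
  define g where "g x = 4 * x / (1 + x\<^sup>2) * - V x" for x
  have nz: "1 + x\<^sup>2 > 0" for x :: real
    by (metis add_pos_nonneg zero_le_power2 zero_less_one)
  have "(g has_integral (- 2 * (ln (1 + 1\<^sup>2) * V 1) - 2 * W 1)
      - (- 2 * (ln (1 + 0\<^sup>2) * V 0) - 2 * W 0)) {0..1}"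
  \<comment> \<open>Derivatives are taken in the interior only, since the formulas for
    \<open>Li2\<close> and \<open>P\<close> exclude the point 0.\<close>
  proof (rule fundamental_theorem_of_calculus_interior)
    show "continuous_on {0..1} (\<lambda>x. - 2 * (ln (1 + x\<^sup>2) * V x) - 2 * W x)"
      unfolding V_def W_def using nz
      by (intro continuous_intros continuous_on_rotated holomorphic_Li2 P) (metis less_irrefl)
    fix x :: real assume x: "x \<in> {0<..<1}"
    define z where "z = - (\<i> * complex_of_real x)"
    define l where "l = Ln (1 - z)"
    have z: "z \<in> slit_plane" "z \<noteq> 0"
      using x rotated_in_slit_plane by (auto simp: z_def)
    have "cmod (1 - z) = sqrt (1 + x\<^sup>2)" by (simp add: z_def cmod_def)
    moreover have "1 - z \<noteq> 0" using z by (auto simp: slit_plane_iff)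
    \<comment> \<open>As 1 - z = 1 + ix has squared modulus 1 + x^2, the real logarithm is twice
      \<open>Re l\<close>. Hence the derivative of \<open>W\<close> is ln(1 + x^2) times
      \<open>Im l / x\<close>, which cancels the unwanted term from the product rule.\<close>
    ultimately have l: "ln (1 + x\<^sup>2) = 2 * Re l"
      using nz by (simp add: l_def ln_sqrt)
    have "- Re (- l / z) = - (Im l / x)" "- Re (l\<^sup>2 / z) = 2 * Re l * Im l / x"
      using x by (simp_all add: z_def Re_divide power2_eq_square field_simps)
    then have V': "(V has_real_derivative - (Im l / x)) (at x)"
      and W': "(W has_real_derivative 2 * Re l * Im l / x) (at x)"
      using rotated_Im_deriv[of Li2 "- l / z" x] rotated_Im_deriv[of P "l\<^sup>2 / z" x]
        Li2_deriv[OF z] P'[OF z] unfolding V_def W_def l_def z_def by simp_all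
    have "((\<lambda>x. ln (1 + x\<^sup>2)) has_real_derivative 2 * x / (1 + x\<^sup>2)) (at x)"
      using nz[of x] by (auto intro!: derivative_eq_intros)
    then have "((\<lambda>x. - 2 * (ln (1 + x\<^sup>2) * V x) - 2 * W x) has_real_derivative
        - 2 * (2 * x / (1 + x\<^sup>2) * V x + - (Im l / x) * ln (1 + x\<^sup>2))
        - 2 * (2 * Re l * Im l / x)) (at x)"
      by (intro DERIV_diff DERIV_cmult DERIV_mult V' W')
    moreover have "- 2 * (2 * x / (1 + x\<^sup>2) * V x + - (Im l / x) * ln (1 + x\<^sup>2))
        - 2 * (2 * Re l * Im l / x) = g x"
      unfolding l g_def by (simp add: algebra_simps)
    ultimately show "((\<lambda>x. - 2 * (ln (1 + x\<^sup>2) * V x) - 2 * W x) has_vector_derivative g x) (at x)"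
      by (simp add: has_real_derivative_iff_has_vector_derivative)
  qed simp
  then have g: "(g has_integral 2 * ln 2 * catalan - 2 * Im (P (- \<i>))) {0..1}"
    by (simp add: V_def W_def Im_Li2_minus_ii P mult.assoc)
  \<comment> \<open>The integral of \<open>a k\<close> over [0,1] is the k-th term of
    \<open>Theta2_full 0\<close>.\<close>
  define a where "a k x = (-1) ^ k / (2 * real k + 1)\<^sup>2 * (4 * x ^ (2 * k + 2) / (1 + x\<^sup>2))" for k and x :: real
  have "uniform_limit {0..1} (\<lambda>n x. \<Sum>k<n. a k x) (\<lambda>x. \<Sum>k. a k x) sequentially"
  proof (rule Weierstrass_m_test)
    fix k and x :: real assume x: "x \<in> {0..1}"
    have "4 * x ^ (2 * k + 2) / (1 + x\<^sup>2) \<le> 4 * 1 / 1"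
      using x by (intro frac_le mult_left_mono power_le_one) auto
    then have "1 / (2 * real k + 1)\<^sup>2 * (4 * x ^ (2 * k + 2) / (1 + x\<^sup>2)) \<le> 1 / (2 * real k + 1)\<^sup>2 * 4"
      by (intro mult_left_mono) auto
    moreover have "norm (a k x) = 1 / (2 * real k + 1)\<^sup>2 * (4 * x ^ (2 * k + 2) / (1 + x\<^sup>2))"
      using x nz[of x] by (simp add: a_def abs_mult)
    ultimately show "norm (a k x) \<le> 4 / (2 * real k + 1)\<^sup>2" by simp
  qed (rule summable_four_over_odd_squares)
  moreover have "(\<Sum>k. a k x) = g x" if x: "x \<in> {0..1}" for x
  proof -
    have "summable (\<lambda>k. (-1) ^ k * x ^ (2 * k + 1) / (2 * real k + 1)\<^sup>2)"
    proof (rule summable_comparison_test'[OF summable_inverse_odd_squares])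
      fix k :: nat
      have "x ^ (2 * k + 1) \<le> 1" using x by (intro power_le_one) auto
      then show "norm ((-1) ^ k * x ^ (2 * k + 1) / (2 * real k + 1)\<^sup>2) \<le> 1 / (2 * real k + 1)\<^sup>2"
        using x by (simp add: abs_mult divide_right_mono)
    qed
    from suminf_mult[OF this, of "4 * x / (1 + x\<^sup>2)"]
    show ?thesis unfolding Im_Li2_suminf[OF x] g_def V_def a_def
      by (simp add: mult_ac)
  qed
  ultimately have "uniform_limit {0..1} (\<lambda>n x. \<Sum>k<n. a k x) g sequentially"
    using uniform_limit_cong'[of "{0..1}" "\<lambda>n x. \<Sum>k<n. a k x" "\<lambda>n x. \<Sum>k<n. a k x"
        "\<lambda>x. \<Sum>k. a k x" g sequentially] by blast
  then obtain I J where IJ: "\<And>n. ((\<lambda>x. \<Sum>k<n. a k x) has_integral I n) {0..1}"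
      "(g has_integral J) {0..1}" "I \<longlonglongrightarrow> J"
  proof (rule uniform_limit_integral)
    show "continuous_on {0..1} (\<lambda>x. \<Sum>k<n. a k x)" for n
      unfolding a_def using nz by (intro continuous_intros) (metis less_irrefl)
  qed auto
  have "I n = (\<Sum>k<n. (-1) ^ k / (2 * real k + 1)\<^sup>2 * digamma_gap k)" for n
    by (rule has_integral_unique[OF IJ(1)], unfold a_def)
       (intro has_integral_sum has_integral_mult_right digamma_gap_integral finite_lessThan)
  then have "I = (\<lambda>n. \<Sum>k<n. (-1) ^ k / (2 * real k + 1)\<^sup>2 * digamma_gap k)" ..
  then have "(\<lambda>k. (-1) ^ k / (2 * real k + 1)\<^sup>2 * digamma_gap k) sums J"
    using IJ(3) unfolding sums_def by simp
  moreover have "J = 2 * ln 2 * catalan - 2 * Im (P (- \<i>))"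
    using has_integral_unique[OF IJ(2) g] .
  ultimately show ?thesis
    using Theta2_full_sums[of 0] sums_unique2 by fastforce
qed

text \<open>The term ln 2 times Im Li2(-i) = -G in the value of P(-i) cancels the 2 G ln 2 from the
  integral.\<close>

lemma Theta2_full_0:
  "Theta2_full 0 = - (1/4 * (ln 2)\<^sup>2 * pi) - pi ^ 3 / 8 + 4 * Im (Li3 (1 + \<i>))"
proof -
  obtain P where P: "P holomorphic_on slit_plane" "P 0 = 0"
    "\<And>z. z \<in> slit_plane \<Longrightarrow> z \<noteq> 0 \<Longrightarrow> (P has_field_derivative (Ln (1 - z))\<^sup>2 / z) (at z)"
    by (rule log_primitive[of "\<lambda>z. (Ln (1 - z))\<^sup>2"])
       (auto intro!: holomorphic_on_power holomorphic_Ln_one_minus)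
  show ?thesis
    using Theta2_full_0_integral[OF P] Im_primitive_at_minus_ii[OF P] Im_Li2_minus_ii
    by (simp add: field_simps)
qed

section \<open>Closed forms by parity\<close>

lemma Theta2_at_1_even:
  "Theta2_at_1 (2 * p) =
         -4 + 1/4 * (\<Sum>j = 1..p. 1 / ((real j)\<^sup>2 * (4 * real j - 1)))
         - 4 * (\<Sum>j = 1..2 * p. (-1) ^ j / (2 * real j + 1))
         - 1/4 * (\<Sum>k = 1..p. \<Sum>j = 0..2 * k - 2.
             (-1) ^ j * (8 * (real k)\<^sup>2 - 4 * real k + 1)
               / ((real k)\<^sup>2 * (2 * real j + 1) * (2 * real k - 1)\<^sup>2))
         + (1 + 1/2 * (\<Sum>j = 1..p. 1 / (2 * real j - 1)\<^sup>2) - 1/4 * (ln 2)\<^sup>2) * pi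
         - pi ^ 3 / 8
         - catalan * (\<Sum>j = 1..p. 1 / (real j * (2 * real j - 1)))
         + 4 * Im (Li3 (1 + \<i>))"
proof -
  \<comment> \<open>Subtracting this gap, the omitted k = 0 term, contributes the constant -4 (from
    j = 0), the single alternating sum and one pi.\<close>
  have "digamma_gap (2 * p) = 4 + 4 * (\<Sum>j = 1..2 * p. (-1) ^ j / (2 * real j + 1)) - pi"
    using digamma_gap_closed_form[of "2 * p"] by (simp add: sum.atLeast_Suc_atMost)
  then show ?thesis
    unfolding Theta2_at_1_eq Theta2_full_even Theta2_full_0
    by (simp only: distrib_right left_diff_distrib)
qed

lemma Theta2_at_1_odd:
  "Theta2_at_1 (2 * p + 1) =
         5 - (\<Sum>j = 1..p. 1 / (4 * (real j)\<^sup>2 * (4 * real j + 1)))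
         + 4 * (\<Sum>j = 1..2 * p + 1. (-1) ^ j / (2 * real j + 1))
         + 1/4 * (\<Sum>k = 1..p. \<Sum>j = 0..2 * k.
             (-1) ^ j * (8 * (real k)\<^sup>2 + 4 * real k + 1)
               / ((real k)\<^sup>2 * (2 * real j + 1) * (2 * real k + 1)\<^sup>2))
         + (2 - (\<Sum>j = 1..p. 1 / (real j * (2 * real j + 1)))) * catalan
         - (3 + (\<Sum>j = 1..p. 1 / (2 * real j + 1)\<^sup>2) - 1/2 * (ln 2)\<^sup>2) * (pi / 2)
         + pi ^ 3 / 8 - 4 * Im (Li3 (1 + \<i>))"
proof -
  \<comment> \<open>Subtracting it contributes 4 - pi; together with 1 - pi/2 from
    \<open>Theta2_full_1\<close> this gives the constants 5 and -3 pi/2.\<close>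
  have "digamma_gap (2 * p + 1) = pi - 4 - 4 * (\<Sum>j = 1..2 * p + 1. (-1) ^ j / (2 * real j + 1))"
    using digamma_gap_closed_form[of "2 * p + 1"]
    by (simp add: sum.atLeast_Suc_atMost[of 0] del: sum.atLeast0_atMost_Suc sum.cl_ivl_Suc)
  then show ?thesis
    unfolding Theta2_at_1_eq Theta2_full_odd Theta2_full_1 Theta2_full_0
    by (simp only: distrib_right left_diff_distrib)
qed

theorem theorem2:
  fixes n :: nat
  shows
    "(n = 0 \<longrightarrow>
       Theta2_at_1 0 = -4 + (1 - 1/4 * (ln 2)\<^sup>2) * pi - pi ^ 3 / 8 + 4 * Im (Li3 (1 + \<i>)))
   \<and> (n = 1 \<longrightarrow>
       Theta2_at_1 1 = 11/3 - (3 - 1/2 * (ln 2)\<^sup>2) * (pi / 2) + pi ^ 3 / 8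
         + 2 * catalan - 4 * Im (Li3 (1 + \<i>)))
   \<and> (odd n \<and> n \<noteq> 1 \<longrightarrow>
       Theta2_at_1 n =
         5 - (\<Sum>j = 1..(n - 1) div 2. 1 / (4 * (real j)\<^sup>2 * (4 * real j + 1)))
         + 4 * (\<Sum>j = 1..n. (-1) ^ j / (2 * real j + 1))
         + 1/4 * (\<Sum>k = 1..(n - 1) div 2. \<Sum>j = 0..2 * k.
             (-1) ^ j * (8 * (real k)\<^sup>2 + 4 * real k + 1)
               / ((real k)\<^sup>2 * (2 * real j + 1) * (2 * real k + 1)\<^sup>2))
         + (2 - (\<Sum>j = 1..(n - 1) div 2. 1 / (real j * (2 * real j + 1)))) * catalan
         - (3 + (\<Sum>j = 1..(n - 1) div 2. 1 / (2 * real j + 1)\<^sup>2) - 1/2 * (ln 2)\<^sup>2) * (pi / 2)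
         + pi ^ 3 / 8 - 4 * Im (Li3 (1 + \<i>)))
   \<and> (even n \<longrightarrow>
       Theta2_at_1 n =
         -4 + 1/4 * (\<Sum>j = 1..n div 2. 1 / ((real j)\<^sup>2 * (4 * real j - 1)))
         - 4 * (\<Sum>j = 1..n. (-1) ^ j / (2 * real j + 1))
         - 1/4 * (\<Sum>k = 1..n div 2. \<Sum>j = 0..2 * k - 2.
             (-1) ^ j * (8 * (real k)\<^sup>2 - 4 * real k + 1)
               / ((real k)\<^sup>2 * (2 * real j + 1) * (2 * real k - 1)\<^sup>2))
         + (1 + 1/2 * (\<Sum>j = 1..n div 2. 1 / (2 * real j - 1)\<^sup>2) - 1/4 * (ln 2)\<^sup>2) * pi
         - pi ^ 3 / 8
         - catalan * (\<Sum>j = 1..n div 2. 1 / (real j * (2 * real j - 1)))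
         + 4 * Im (Li3 (1 + \<i>)))"
proof (intro conjI impI, goal_cases)
  case 1
  then show ?case using Theta2_at_1_even[of 0] by simp
next
  \<comment> \<open>At p = 0 the only nonempty sum is the single alternating one, and 5 - 4/3 =
    11/3.\<close>
  case 2
  then show ?case using Theta2_at_1_odd[of 0] by simp
next
  case 3
  then have "2 * ((n - 1) div 2) + 1 = n" by presburger
  with Theta2_at_1_odd[of "(n - 1) div 2"] show ?case by (simp only:)
next
  case 4
  then have "2 * (n div 2) = n" by presburger
  with Theta2_at_1_even[of "n div 2"] show ?case by (simp only:)
qed

end
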